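(* Let $C_\Phi:\mathcal{H}^\infty\to\mathcal{H}^\infty$, $C_\Phi f=f\circ\Phi$, be a bounded composition operator with symbol $\Phi:\mathbb{C}_+\to\mathbb{C}_+$. Then the following statements are equivalent: (a) $\Phi(\mathbb{C}_+)\subset\mathbb{C}_\varepsilon$ for some $\varepsilon>0$. (b) $C_\Phi$ is compact. (c) $C_\Phi$ is weakly compact. (d) $C_\Phi:\mathcal{H}^\infty\to\mathcal{H}^\infty$ does not fix a copy of $\ell^\infty$.
   Context: For $\theta\in\mathbb{R}$, $\mathbb{C}_\theta=\{s\in\mathbb{C}:\mathrm{Re}(s)>\theta\}$ and $\mathbb{C}_+=\mathbb{C}_0$. $\mathcal{H}^\infty$ is the Banach space of Dirichlet series $f(s)=\sum_{n\ge1}a_nn^{-s}$ convergent in $\mathbb{C}_+$ with $\|f\|_\infty=\sup_{s\in\mathbb{C}_+}|f(s)|<\infty$. Given Banach spaces $X,Y,E$, a bounded operator $T:X\to Y$ fixes a copy of $E$ if there is a subspace $Z\subseteq X$ isomorphic to $E$ such that $T:Z\to T(Z)$ is an isomorphism. $\ell^\infty$ is the Banach space of bounded complex sequences with the sup norm. *)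

theory Defs
  imports "HOL-Analysis.Analysis"
begin

section \<open>Complex normed spaces\<close>

text \<open>The library provides real normed spaces only. A complex normed space is a real one with a
  compatible multiplication by complex scalars; the topology is that of the real normed space.\<close>

class complex_normed_vector = real_normed_vector +
  fixes scaleC :: "complex \<Rightarrow> 'a \<Rightarrow> 'a" (infixr "*\<^sub>C" 75)
  assumes scaleC_add_right: "c *\<^sub>C (x + y) = c *\<^sub>C x + c *\<^sub>C y"
    and scaleC_add_left: "(c + d) *\<^sub>C x = c *\<^sub>C x + d *\<^sub>C x"
    and scaleC_scaleC: "c *\<^sub>C d *\<^sub>C x = (c * d) *\<^sub>C x"
    and scaleC_of_real: "complex_of_real r *\<^sub>C x = r *\<^sub>R x"
    and norm_scaleC: "norm (c *\<^sub>C x) = cmod c * norm x"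

instantiation complex :: complex_normed_vector
begin

definition scaleC_complex :: "complex \<Rightarrow> complex \<Rightarrow> complex"
  where "c *\<^sub>C z = c * z"

instance
  by standard (auto simp: scaleC_complex_def algebra_simps norm_mult scaleR_conv_of_real)

end

instantiation bcontfun :: (topological_space, complex_normed_vector) complex_normed_vector
begin

definition scaleC_bcontfun :: "complex \<Rightarrow> ('a \<Rightarrow>\<^sub>C 'b) \<Rightarrow> 'a \<Rightarrow>\<^sub>C 'b"
  where "c *\<^sub>C f = Bcontfun (\<lambda>x. c *\<^sub>C apply_bcontfun f x)"

lemma bounded_linear_scaleC: "bounded_linear (\<lambda>x::'b. c *\<^sub>C x)"
proof (rule bounded_linear_intro[where K = "cmod c"])
  fix x y :: 'b and r :: real
  show "c *\<^sub>C (x + y) = c *\<^sub>C x + c *\<^sub>C y"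
    by (rule scaleC_add_right)
  have "c *\<^sub>C (r *\<^sub>R x) = (c * of_real r) *\<^sub>C x"
    by (simp add: scaleC_scaleC flip: scaleC_of_real)
  also have "\<dots> = r *\<^sub>R (c *\<^sub>C x)"
    by (simp add: scaleC_scaleC mult.commute flip: scaleC_of_real)
  finally show "c *\<^sub>C (r *\<^sub>R x) = r *\<^sub>R (c *\<^sub>C x)" .
  show "norm (c *\<^sub>C x) \<le> norm x * cmod c"
    by (simp add: norm_scaleC mult.commute)
qed

lemma apply_bcontfun_scaleC [simp]: "apply_bcontfun (c *\<^sub>C f) x = c *\<^sub>C apply_bcontfun f x"
  for f :: "'a \<Rightarrow>\<^sub>C 'b"
proof -
  have "(\<lambda>x. c *\<^sub>C apply_bcontfun f x) \<in> bcontfun"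
  proof (rule bcontfun_normI)
    show "continuous_on UNIV (\<lambda>x. c *\<^sub>C apply_bcontfun f x)"
      by (rule bounded_linear.continuous_on[OF bounded_linear_scaleC]) simp
    show "norm (c *\<^sub>C apply_bcontfun f x) \<le> cmod c * norm f" for x
      by (simp add: norm_scaleC norm_bounded mult_left_mono)
  qed
  then show ?thesis
    by (simp add: scaleC_bcontfun_def Bcontfun_inverse)
qed

instance
proof
  fix c d :: complex and r :: real and f g :: "'a \<Rightarrow>\<^sub>C 'b"
  show "c *\<^sub>C (f + g) = c *\<^sub>C f + c *\<^sub>C g"
    by (rule bcontfun_eqI) (simp add: scaleC_add_right)
  show "(c + d) *\<^sub>C f = c *\<^sub>C f + d *\<^sub>C f"
    by (rule bcontfun_eqI) (simp add: scaleC_add_left)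
  show assoc: "c *\<^sub>C d *\<^sub>C f = (c * d) *\<^sub>C f" for c d and f :: "'a \<Rightarrow>\<^sub>C 'b"
    by (rule bcontfun_eqI) (simp add: scaleC_scaleC)
  show of_real: "complex_of_real r *\<^sub>C f = r *\<^sub>R f" for r and f :: "'a \<Rightarrow>\<^sub>C 'b"
    by (rule bcontfun_eqI) (simp add: scaleC_of_real)
  have le: "norm (c *\<^sub>C f) \<le> cmod c * norm f" for c and f :: "'a \<Rightarrow>\<^sub>C 'b"
    by (rule norm_bound) (simp add: norm_scaleC norm_bounded mult_left_mono)
  show "norm (c *\<^sub>C f) = cmod c * norm f"
  proof (cases "c = 0")
    case True
    then show ?thesis using le[of c f] by simp
  next
    case False
    have "f = inverse c *\<^sub>C c *\<^sub>C f"
      using of_real[of 1 f] False by (simp add: assoc)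
    then have "norm f \<le> cmod (inverse c) * norm (c *\<^sub>C f)"
      using le[of "inverse c" "c *\<^sub>C f"] by simp
    then have "cmod c * norm f \<le> norm (c *\<^sub>C f)"
      using False by (simp add: norm_divide field_simps)
    with le[of c f] show ?thesis by simp
  qed
qed

end

text \<open>Since \<^typ>\<open>nat\<close> is discrete, every bounded sequence is a bounded continuous function.\<close>

type_synonym linfty = "nat \<Rightarrow>\<^sub>C complex"

lemma bounded_sequence_linfty:
  assumes "bounded (range a)"
  obtains x :: linfty where "apply_bcontfun x = a"
proof
  show "apply_bcontfun (Bcontfun a) = a"
    using assms by (intro Bcontfun_inverse) (simp add: bcontfun_def)
qed

lemma norm_linfty: "norm (x :: linfty) = (SUP n. cmod (x n))"
proof (rule antisym)
  have bdd: "bdd_above (range (\<lambda>n. cmod (x n)))"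
    by (rule bdd_aboveI2[where M = "norm x"]) (rule norm_bounded)
  show "norm x \<le> (SUP n. cmod (x n))"
    by (rule norm_bound) (auto intro: cSUP_upper bdd)
  show "(SUP n. cmod (x n)) \<le> norm x"
    by (rule cSUP_least) (auto intro: norm_bounded)
qed


section \<open>Bounded operators\<close>

definition bounded_clinear :: "('a::complex_normed_vector \<Rightarrow> 'b::complex_normed_vector) \<Rightarrow> bool"
  where "bounded_clinear T \<longleftrightarrow> bounded_linear T \<and> (\<forall>c x. T (c *\<^sub>C x) = c *\<^sub>C T x)"

definition weak_topology :: "'a::complex_normed_vector topology"
  where "weak_topology = topology_generated_by
    {\<phi> -` U |(\<phi> :: 'a \<Rightarrow> complex) U. bounded_clinear \<phi> \<and> open U}"

lemma bounded_clinear_zero: "bounded_clinear (\<lambda>_::'a::complex_normed_vector. 0::complex)"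
  by (simp add: bounded_clinear_def scaleC_complex_def)

lemma topspace_weak_topology: "topspace weak_topology = UNIV"
proof -
  have "UNIV = (\<lambda>_::'a. 0::complex) -` UNIV"
    by simp
  then have "UNIV \<in> {\<phi> -` U |(\<phi> :: 'a \<Rightarrow> complex) U. bounded_clinear \<phi> \<and> open U}"
    using bounded_clinear_zero by blast
  then show ?thesis
    unfolding weak_topology_def topology_generated_by_topspace by blast
qed

definition compact_operator :: "('a::complex_normed_vector \<Rightarrow> 'b::complex_normed_vector) \<Rightarrow> bool"
  where "compact_operator T \<longleftrightarrow> bounded_clinear T \<and> compact (closure (T ` cball 0 1))"

definition weakly_compact_operator ::
    "('a::complex_normed_vector \<Rightarrow> 'b::complex_normed_vector) \<Rightarrow> bool"
  where "weakly_compact_operator T \<longleftrightarrow> bounded_clinear T \<and>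
    compactin weak_topology (weak_topology closure_of (T ` cball 0 1))"

definition csubspace :: "'a::complex_normed_vector set \<Rightarrow> bool"
  where "csubspace Z \<longleftrightarrow> 0 \<in> Z \<and> (\<forall>x\<in>Z. \<forall>y\<in>Z. x + y \<in> Z) \<and> (\<forall>c. \<forall>x\<in>Z. c *\<^sub>C x \<in> Z)"

text \<open>Isomorphisms between subspaces are linear homeomorphisms, not necessarily isometric.\<close>

definition normed_isomorphism ::
    "'a::complex_normed_vector set \<Rightarrow> 'b::complex_normed_vector set \<Rightarrow> ('a \<Rightarrow> 'b) \<Rightarrow> bool"
  where "normed_isomorphism Z W T \<longleftrightarrow>
    (\<forall>x\<in>Z. \<forall>y\<in>Z. T (x + y) = T x + T y) \<and> (\<forall>c. \<forall>x\<in>Z. T (c *\<^sub>C x) = c *\<^sub>C T x) \<and>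
    (\<exists>S. homeomorphism Z W T S)"

definition fixes_copy ::
    "('a::complex_normed_vector \<Rightarrow> 'b::complex_normed_vector) \<Rightarrow>
      'e::complex_normed_vector itself \<Rightarrow> bool"
  where "fixes_copy T _ \<longleftrightarrow>
    (\<exists>Z. csubspace Z \<and> (\<exists>J. normed_isomorphism (UNIV :: 'e set) Z J) \<and>
      normed_isomorphism Z (T ` Z) T)"


section \<open>Bounded Dirichlet series\<close>

definition halfplane :: "real \<Rightarrow> complex set"
  where "halfplane \<theta> = {s. Re s > \<theta>}"

lemma halfplane_nonempty [simp]: "halfplane \<theta> \<noteq> {}"
proof -
  have "Complex (\<theta> + 1) 0 \<in> halfplane \<theta>" by (simp add: halfplane_def)
  then show ?thesis by blast
qed

text \<open>An element is represented by its sum function on the right half-plane, extended by \<open>0\<close>. This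
  extension only makes the representing total function unique. The term \<open>n\<close> of the library series
  is the one with index \<open>n + 1\<close> of the Dirichlet series.\<close>

definition hinf_set :: "(complex \<Rightarrow> complex) set"
  where "hinf_set = {f.
    (\<exists>a :: nat \<Rightarrow> complex. \<forall>s\<in>halfplane 0. (\<lambda>n. a (Suc n) * of_nat (Suc n) powr (- s)) sums f s) \<and>
    bounded (f ` halfplane 0) \<and> (\<forall>s. s \<notin> halfplane 0 \<longrightarrow> f s = 0)}"

lemma hinf_set_zero: "(\<lambda>_. 0) \<in> hinf_set"
  by (simp add: hinf_set_def image_constant_conv exI[of _ "\<lambda>_. 0"])

lemma hinf_set_add:
  assumes "f \<in> hinf_set" "g \<in> hinf_set"
  shows "(\<lambda>s. f s + g s) \<in> hinf_set"
proof -
  obtain a b where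
    "\<forall>s\<in>halfplane 0. (\<lambda>n. a (Suc n) * of_nat (Suc n) powr (- s)) sums f s"
    "\<forall>s\<in>halfplane 0. (\<lambda>n. b (Suc n) * of_nat (Suc n) powr (- s)) sums g s"
    using assms by (auto simp: hinf_set_def)
  then have "\<forall>s\<in>halfplane 0.
      (\<lambda>n. (a (Suc n) + b (Suc n)) * of_nat (Suc n) powr (- s)) sums (f s + g s)"
    by (auto simp only: distrib_right intro!: sums_add)
  then have "\<exists>c. \<forall>s\<in>halfplane 0.
      (\<lambda>n. c (Suc n) * of_nat (Suc n) powr (- s)) sums (f s + g s)"
    by (intro exI[of _ "\<lambda>n. a n + b n"]) simp
  then show ?thesis
    using assms by (auto simp: hinf_set_def intro: bounded_plus_comp)
qed

lemma hinf_set_mult: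
  assumes "f \<in> hinf_set"
  shows "(\<lambda>s. c * f s) \<in> hinf_set"
proof -
  obtain a where
    "\<forall>s\<in>halfplane 0. (\<lambda>n. a (Suc n) * of_nat (Suc n) powr (- s)) sums f s"
    using assms by (auto simp: hinf_set_def)
  then have "\<forall>s\<in>halfplane 0.
      (\<lambda>n. (c * a (Suc n)) * of_nat (Suc n) powr (- s)) sums (c * f s)"
    by (auto simp only: mult.assoc intro!: sums_mult)
  then have "\<exists>b. \<forall>s\<in>halfplane 0.
      (\<lambda>n. b (Suc n) * of_nat (Suc n) powr (- s)) sums (c * f s)"
    by (intro exI[of _ "\<lambda>n. c * a n"]) simp
  moreover have "bounded ((\<lambda>s. c * f s) ` halfplane 0)"
    using assms bounded_linear_image[OF _ bounded_linear_mult_right[of c], of "f ` halfplane 0"]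
    by (simp add: hinf_set_def image_image)
  ultimately show ?thesis
    using assms by (auto simp: hinf_set_def)
qed

typedef hinf = hinf_set
  morphisms hinf_fun Abs_hinf
  using hinf_set_zero by blast

setup_lifting type_definition_hinf

lemma hinf_eqI: "(\<And>s. s \<in> halfplane 0 \<Longrightarrow> hinf_fun f s = hinf_fun g s) \<Longrightarrow> f = g"
proof -
  assume eq: "\<And>s. s \<in> halfplane 0 \<Longrightarrow> hinf_fun f s = hinf_fun g s"
  have "hinf_fun f s = hinf_fun g s" for s
    using eq[of s] hinf_fun[of f] hinf_fun[of g]
    by (cases "s \<in> halfplane 0") (simp_all add: hinf_set_def)
  then show ?thesis
    by (simp add: hinf_fun_inject[symmetric] fun_eq_iff)
qed

instantiation hinf :: real_vector
begin

lift_definition zero_hinf :: hinf is "\<lambda>_. 0"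
  by (rule hinf_set_zero)

lift_definition plus_hinf :: "hinf \<Rightarrow> hinf \<Rightarrow> hinf" is "\<lambda>f g s. f s + g s"
  by (rule hinf_set_add)

lift_definition uminus_hinf :: "hinf \<Rightarrow> hinf" is "\<lambda>f s. - f s"
  using hinf_set_mult[of _ "-1"] by simp

lift_definition minus_hinf :: "hinf \<Rightarrow> hinf \<Rightarrow> hinf" is "\<lambda>f g s. f s - g s"
  using hinf_set_add[OF _ hinf_set_mult[of _ "-1"]] by simp

lift_definition scaleR_hinf :: "real \<Rightarrow> hinf \<Rightarrow> hinf" is "\<lambda>r f s. of_real r * f s"
  by (rule hinf_set_mult)

lemmas hinf_fun_simps [simp] =
  zero_hinf.rep_eq plus_hinf.rep_eq uminus_hinf.rep_eq minus_hinf.rep_eq scaleR_hinf.rep_eq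

instance
  by standard (auto intro!: hinf_eqI simp: algebra_simps)

end

instantiation hinf :: complex_normed_vector
begin

lift_definition scaleC_hinf :: "complex \<Rightarrow> hinf \<Rightarrow> hinf" is "\<lambda>c f s. c * f s"
  by (rule hinf_set_mult)

declare scaleC_hinf.rep_eq [simp]

definition norm_hinf :: "hinf \<Rightarrow> real"
  where "norm f = (SUP s\<in>halfplane 0. cmod (hinf_fun f s))"

definition dist_hinf :: "hinf \<Rightarrow> hinf \<Rightarrow> real"
  where "dist f g = norm (f - g :: hinf)"

definition sgn_hinf :: "hinf \<Rightarrow> hinf"
  where "sgn (f :: hinf) = f /\<^sub>R norm f"

definition uniformity_hinf :: "(hinf \<times> hinf) filter"
  where "uniformity_hinf = (INF e\<in>{0<..}. principal {(x, y). dist x y < e})"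

definition open_hinf :: "hinf set \<Rightarrow> bool"
  where "open_hinf S = (\<forall>x\<in>S. \<forall>\<^sub>F (x', y) in uniformity. x' = x \<longrightarrow> y \<in> S)"

lemma cmod_hinf_fun_le_norm:
  assumes "s \<in> halfplane 0"
  shows "cmod (hinf_fun f s) \<le> norm f"
proof -
  have "bounded (hinf_fun f ` halfplane 0)"
    using hinf_fun[of f] by (simp add: hinf_set_def)
  then have "bdd_above ((\<lambda>s. cmod (hinf_fun f s)) ` halfplane 0)"
    by (auto simp: bounded_iff bdd_above_def)
  then show ?thesis
    unfolding norm_hinf_def using assms by (rule cSUP_upper2) simp
qed

lemma norm_hinf_le:
  assumes "\<And>s. s \<in> halfplane 0 \<Longrightarrow> cmod (hinf_fun f s) \<le> B"
  shows "norm f \<le> B"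
  unfolding norm_hinf_def using assms by (intro cSUP_least) auto

instance
proof
  fix f g :: hinf and c d :: complex and r :: real
  show "c *\<^sub>C (f + g) = c *\<^sub>C f + c *\<^sub>C g" "(c + d) *\<^sub>C f = c *\<^sub>C f + d *\<^sub>C f"
    "c *\<^sub>C d *\<^sub>C f = (c * d) *\<^sub>C f"
    by (auto intro!: hinf_eqI simp: algebra_simps)
  show scale: "complex_of_real r *\<^sub>C f = r *\<^sub>R f" for r and f :: hinf
    by (rule hinf_eqI) simp
  show "dist f g = norm (f - g :: hinf)"
    by (rule dist_hinf_def)
  show "sgn f = f /\<^sub>R norm f"
    by (rule sgn_hinf_def)
  show "uniformity = (INF e\<in>{0<..}. principal {(x, y :: hinf). dist x y < e})"
    by (rule uniformity_hinf_def)
  show "open S = (\<forall>x\<in>S. \<forall>\<^sub>F (x', y) in uniformity. x' = x \<longrightarrow> y \<in> S)" for S :: "hinf set"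
    by (rule open_hinf_def)
  show "norm f = 0 \<longleftrightarrow> f = 0"
  proof
    assume "norm f = 0"
    then show "f = 0"
      using cmod_hinf_fun_le_norm[of _ f] by (intro hinf_eqI) simp
  qed (simp add: norm_hinf_def)
  show "norm (f + g) \<le> norm f + norm g"
    by (rule norm_hinf_le)
      (auto intro!: norm_triangle_le add_mono cmod_hinf_fun_le_norm)
  have le: "norm (c *\<^sub>C f) \<le> cmod c * norm f" for c and f :: hinf
    by (rule norm_hinf_le) (simp add: norm_mult cmod_hinf_fun_le_norm mult_left_mono)
  show norm_C: "norm (c *\<^sub>C f) = cmod c * norm f" for c and f :: hinf
  proof (cases "c = 0")
    case True
    then show ?thesis by (simp add: norm_hinf_def)
  next
    case False
    then have "inverse c *\<^sub>C c *\<^sub>C f = f"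
      by (intro hinf_eqI) simp
    then have "norm f \<le> cmod (inverse c) * norm (c *\<^sub>C f)"
      using le[of "inverse c" "c *\<^sub>C f"] by simp
    then have "cmod c * norm f \<le> norm (c *\<^sub>C f)"
      using False by (simp add: norm_divide field_simps)
    with le[of c f] show ?thesis by simp
  qed
  show "norm (r *\<^sub>R f) = \<bar>r\<bar> * norm f"
    using norm_C[of "complex_of_real r" f] by (simp add: scale)
qed

end

lifting_update hinf.lifting
lifting_forget hinf.lifting

definition is_composition_operator :: "(complex \<Rightarrow> complex) \<Rightarrow> (hinf \<Rightarrow> hinf) \<Rightarrow> bool"
  where "is_composition_operator \<Phi> C \<longleftrightarrow>
    (\<forall>f. \<forall>s\<in>halfplane 0. hinf_fun (C f) s = (hinf_fun f \<circ> \<Phi>) s)"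

end

theory Submission
  imports Defs "HOL-Complex_Analysis.Complex_Analysis" "HOL-Real_Asymp.Real_Asymp"
begin

text \<open>If \<open>\<Phi>\<close> maps into a smaller half-plane \<open>Re s > \<epsilon>\<close>, compactness is a Montel theorem: bounded sequences
  of \<open>hinf\<close> have subsequences converging uniformly on \<open>Re s > \<epsilon>\<close>, with a limit in \<open>hinf\<close>. This rests
  on tail estimates for the series that are uniform over the unit ball. They come from a bound
  \<open>C N\<^sup>\<delta>\<close> for the \<open>N\<close>-th partial sums on the whole right half-plane, proved by Newman's contour
  method, and summation by parts.

  If there is no such \<open>\<epsilon>\<close>, choose \<open>s\<^sub>k\<close> with \<open>Re \<Phi>(s\<^sub>k)\<close> tending to \<open>0\<close>. The points \<open>2 powr - \<Phi>(s\<^sub>k)\<close> of the unit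
  disk accumulate at some \<open>\<zeta>\<close> of modulus \<open>1\<close>, and powers of \<open>(1 + cnj \<zeta> * 2 powr - s) / 2\<close> give a
  sequence of gliding humps \<open>h\<^sub>j\<close>. Then \<open>J x = \<Sum>\<^sub>j x\<^sub>j h\<^sub>j\<close> maps \<open>\<ell>\<^sup>\<infinity>\<close> into \<open>hinf\<close>, and \<open>C\<^sub>\<Phi> \<circ> J\<close> is bounded
  below because \<open>J x\<close> takes approximately the value \<open>x\<^sub>i\<close> at the \<open>i\<close>-th selected point. The images of the
  truncations \<open>(1, ..., 1, 0, ...)\<close> have no weak cluster point \<open>g\<close>: a functional extending the limit
  along the selected points vanishes on them, whereas \<open>g\<close> is approximately constant and nonzero there.\<close>

section \<open>A contour estimate\<close>

text \<open>A bounded Dirichlet series may converge only conditionally near the imaginary axis, so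
  normal families alone do not show that a locally uniform limit is again the sum of a Dirichlet
  series. Convergence of the coefficients controls each fixed partial sum; the tails have to be
  small for all members of the ball at once, and on an unbounded half-plane. Growth
  \<open>N powr \<delta>\<close> with arbitrarily small \<delta> is harmless, because a shift by 2
  \<delta> inside the half-plane absorbs it. This is why crude polynomial bounds may enter the
  contour estimate: its radius is a power of \<open>N\<close> and is felt only through a logarithm.

  In the converse direction, \<open>(1 + cnj \<zeta> * z) / 2\<close> maps the unit disk into the
  disk with diameter [0, 1], whose closure meets the unit circle only at 1. A value of modulus close
  to 1 is therefore close to 1, where \<open>z ^ n - z ^ m\<close> is small again. Each hump is thus
  confined to an annulus, and bounded combinations of humps stay bounded.\<close>

lemma contour_integral_part_circlepath_combine:
  assumes "a < b" "b < c" "continuous_on (path_image (part_circlepath z r a c)) f"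
  shows "contour_integral (part_circlepath z r a c) f =
    contour_integral (part_circlepath z r a b) f + contour_integral (part_circlepath z r b c) f"
proof -
  have "f contour_integrable_on part_circlepath z r a c"
    by (rule contour_integrable_continuous_part_circlepath) fact
  then have "(\<lambda>t. f (z + r * cis t) * r * \<i> * cis t) integrable_on {a..c}"
    using assms by (simp add: contour_integrable_part_circlepath_iff)
  from Henstock_Kurzweil_Integration.integral_combine[OF _ _ this, of b] show ?thesis
    using assms by (simp add: contour_integral_part_circlepath_eq)
qed

lemma part_circlepath_shift_2pi:
  "part_circlepath z r (a + 2 * pi) (b + 2 * pi) = part_circlepath z r a b"
proof
  fix x
  have "exp (\<i> * linepath (of_real (a + 2 * pi)) (of_real (b + 2 * pi)) x)
      = exp (\<i> * linepath (of_real a) (of_real b) x) * exp (2 * pi * \<i>)"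
    unfolding exp_add[symmetric] by (simp add: linepath_def algebra_simps scaleR_conv_of_real)
  then show "part_circlepath z r (a + 2 * pi) (b + 2 * pi) x = part_circlepath z r a b x"
    by (simp add: part_circlepath_def of_real_linepath exp_two_pi_i)
qed

text \<open>The parametrization of \<open>circlepath\<close> starts at angle 0, in the middle of the
  right arc. Its last piece has to be moved back by one full turn before it can be joined to the
  first.\<close>

lemma contour_integral_circlepath_arcs:
  assumes "0 < \<alpha>" "\<alpha> < pi" "r > 0" "continuous_on (sphere z r) f"
  shows "contour_integral (circlepath z r) f =
    contour_integral (part_circlepath z r (-\<alpha>) \<alpha>) f +
    contour_integral (part_circlepath z r \<alpha> (2 * pi - \<alpha>)) f"
proof -
  have cont: "continuous_on (path_image (part_circlepath z r a b)) f" for a b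
    using assms(3,4) path_image_part_circlepath_subset'[of r z a b] continuous_on_subset by (simp add: less_imp_le) blast
  note comb = contour_integral_part_circlepath_combine[OF _ _ cont]
  have "contour_integral (circlepath z r) f = contour_integral (part_circlepath z r 0 \<alpha>) f
      + contour_integral (part_circlepath z r \<alpha> (2 * pi)) f"
    unfolding circlepath_def using assms by (intro comb) auto
  also have "contour_integral (part_circlepath z r \<alpha> (2 * pi)) f
      = contour_integral (part_circlepath z r \<alpha> (2 * pi - \<alpha>)) f
      + contour_integral (part_circlepath z r (2 * pi - \<alpha>) (2 * pi)) f"
    using assms by (intro comb) auto
  also have "part_circlepath z r (2 * pi - \<alpha>) (2 * pi) = part_circlepath z r (-\<alpha>) 0"
    using part_circlepath_shift_2pi[of z r "-\<alpha>" 0] by (simp add: algebra_simps)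
  also have "contour_integral (part_circlepath z r 0 \<alpha>) f =
      contour_integral (part_circlepath z r (-\<alpha>) \<alpha>) f - contour_integral (part_circlepath z r (-\<alpha>) 0) f"
    using comb[of "-\<alpha>" 0 \<alpha>] assms by simp
  finally show ?thesis by simp
qed

text \<open>The integrand is the modulus of \<open>1 / w\<close> on the vertical line
  \<open>Re w = \<eta>\<close>.\<close>

lemma has_integral_inverse_sqrt_sum_squares:
  assumes "\<eta> > 0" "Y \<ge> 0"
  shows "((\<lambda>t. 1 / sqrt (\<eta>\<^sup>2 + t\<^sup>2)) has_integral 2 * arsinh (Y / \<eta>)) {-Y..Y}"
proof -
  have "((\<lambda>t. arsinh (t / \<eta>)) has_vector_derivative 1 / sqrt (\<eta>\<^sup>2 + t\<^sup>2)) (at t within {-Y..Y})" for t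
  proof -
    have "(t / \<eta>)\<^sup>2 + 1 = (\<eta>\<^sup>2 + t\<^sup>2) / \<eta>\<^sup>2"
      using assms by (simp add: field_simps)
    then have "sqrt ((t / \<eta>)\<^sup>2 + 1) = sqrt (\<eta>\<^sup>2 + t\<^sup>2) / \<eta>"
      using assms by (simp add: real_sqrt_divide)
    moreover have "((\<lambda>t. arsinh (t / \<eta>)) has_field_derivative 1 / sqrt ((t / \<eta>)\<^sup>2 + 1) * (1 / \<eta>)) (at t within {-Y..Y})"
      using DERIV_chain[OF arsinh_real_has_field_derivative DERIV_cdivide[OF DERIV_ident]]
      by (simp add: o_def)
    ultimately show ?thesis using assms
      by (simp add: has_real_derivative_iff_has_vector_derivative)
  qed
  then have "((\<lambda>t. 1 / sqrt (\<eta>\<^sup>2 + t\<^sup>2)) has_integral arsinh (Y / \<eta>) - arsinh (- Y / \<eta>)) {-Y..Y}"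
    using assms by (intro fundamental_theorem_of_calculus) auto
  then show ?thesis by simp
qed

lemma arsinh_le_ln:
  fixes x::real assumes "x \<ge> 0" shows "arsinh x \<le> ln (1 + 2 * x)"
proof -
  have "sqrt (x\<^sup>2 + 1) \<le> x + 1"
    using assms by (intro real_le_lsqrt) (auto simp: power2_eq_square algebra_simps)
  then have "x + sqrt (x\<^sup>2 + 1) \<le> 1 + 2 * x" by simp
  moreover have "x + sqrt (x\<^sup>2 + 1) > 0" using assms by (simp add: add_nonneg_pos add_pos_nonneg)
  ultimately show ?thesis by (simp add: arsinh_real_def)
qed

text \<open>On the circle the inverse of \<open>w\<close> is \<open>cnj w / R\<^sup>2\<close>. The
  added term is entire, so the residue at 0 is that of \<open>1 / w\<close>.\<close>

lemma Newman_kernel_on_circle: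
  assumes "cmod w = R" "R > 0"
  shows "1 / w + w / of_real (R\<^sup>2) = of_real (2 * Re w / R\<^sup>2)"
proof -
  have "w \<noteq> 0" using assms by auto
  have "w * cnj w = of_real (R\<^sup>2)" using assms by (metis complex_norm_square)
  then have "1 / w = cnj w / of_real (R\<^sup>2)" using \<open>w \<noteq> 0\<close> assms
    by (simp add: field_simps)
  then show ?thesis
    using complex_add_cnj[of w] by (simp add: add_divide_distrib[symmetric] add.commute)
qed

text \<open>The term \<open>1 / w\<close> integrates to an area hyperbolic sine, hence to a
  logarithm of \<open>R / \<eta>\<close>. The other term has modulus at most \<open>1 / R\<close> on
  a chord of length at most \<open>2 * R\<close>, which gives the additive 2.\<close>

lemma norm_chord_integral_le:
  assumes "\<eta> > 0" "Y \<ge> 0" "Y \<le> R" "\<eta> \<le> R" "\<eta>\<^sup>2 + Y\<^sup>2 = R\<^sup>2"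
    and F: "F holomorphic_on {w. Re w > 0}" and B: "\<And>w. Re w = \<eta> \<Longrightarrow> cmod (F w) \<le> B"
  shows "cmod (contour_integral (linepath (Complex \<eta> (-Y)) (Complex \<eta> Y))
      (\<lambda>w. F w * (1 / w + w / of_real (R\<^sup>2)))) \<le> B * (2 * ln (1 + 2 * R / \<eta>) + 2)"
proof (cases "Y = 0")
  case True
  have "B \<ge> 0" using B[of "of_real \<eta>"] norm_ge_zero order_trans by (metis Re_complex_of_real)
  then show ?thesis using True assms by simp
next
  case False
  have "R > 0" using assms by simp
  have Bpos: "B \<ge> 0" using B[of "of_real \<eta>"] norm_ge_zero order_trans by (metis Re_complex_of_real)
  let ?g = "\<lambda>w. F w * (1 / w + w / of_real (R\<^sup>2))"
  have seg: "closed_segment (Complex \<eta> (-Y)) (Complex \<eta> Y) \<subseteq> {w. Re w > 0}"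
  proof -
    have "convex {w. Re w > 0}" by (rule convex_halfspace_Re_gt)
    then show ?thesis using assms by (intro closed_segment_subset) auto
  qed
  have cont: "continuous_on (closed_segment (Complex \<eta> (-Y)) (Complex \<eta> Y)) ?g"
    using seg by (intro continuous_intros continuous_on_subset[OF holomorphic_on_imp_continuous_on[OF F]])
      (use \<open>R > 0\<close> in auto)
  define I where "I = contour_integral (linepath (Complex \<eta> (-Y)) (Complex \<eta> Y)) ?g"
  have "(?g has_contour_integral I) (linepath (Complex \<eta> (-Y)) (Complex \<eta> Y))"
    unfolding I_def using cont contour_integrable_continuous_linepath has_contour_integral_integral by blast
  then have gi: "((\<lambda>t. ?g (Complex \<eta> t)) has_integral (-\<i> * I)) {-Y..Y}"
    using False assms by (subst (asm) has_contour_integral_linepath_same_Re_iff) auto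
  have hi: "((\<lambda>t. B * (1 / sqrt (\<eta>\<^sup>2 + t\<^sup>2) + 1 / R)) has_integral B * (2 * arsinh (Y / \<eta>) + 2 * Y * (1/ R))) {-Y..Y}"
  proof -
    have "((\<lambda>t. 1 / R) has_integral 2 * Y * (1 / R)) {-Y..Y}"
      using has_integral_const_real[of "1/R" "-Y" Y] assms by simp
    then show ?thesis
      by (intro has_integral_mult_right has_integral_add has_integral_inverse_sqrt_sum_squares) (use assms in auto)
  qed
  have le: "cmod (?g (Complex \<eta> t)) \<le> B * (1 / sqrt (\<eta>\<^sup>2 + t\<^sup>2) + 1 / R)" if "t \<in> {-Y..Y}" for t
  proof -
    let ?w = "Complex \<eta> t"
    have "t\<^sup>2 \<le> Y\<^sup>2" using that by (simp add: abs_le_square_iff[symmetric] abs_le_iff)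
    then have wR: "cmod ?w \<le> R"
      using assms \<open>R > 0\<close> by (simp add: cmod_def real_le_lsqrt)
    have "cmod (1 / ?w + ?w / of_real (R\<^sup>2)) \<le> cmod (1 / ?w) + cmod (?w / of_real (R\<^sup>2))"
      by (rule norm_triangle_ineq)
    also have "\<dots> = 1 / sqrt (\<eta>\<^sup>2 + t\<^sup>2) + cmod ?w / R\<^sup>2"
      using \<open>R > 0\<close> by (simp add: norm_divide norm_power) (simp add: cmod_def)
    also have "\<dots> \<le> 1 / sqrt (\<eta>\<^sup>2 + t\<^sup>2) + 1 / R"
      using divide_right_mono[OF wR, of "R\<^sup>2"] \<open>R > 0\<close> by (simp add: power2_eq_square)
    finally show ?thesis using B[of ?w] Bpos
      by (subst norm_mult) (intro mult_mono, auto)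
  qed
  have "cmod (-\<i> * I) \<le> B * (2 * arsinh (Y / \<eta>) + 2 * Y * (1/ R))"
    using Henstock_Kurzweil_Integration.integral_norm_bound_integral[OF has_integral_integrable[OF gi] has_integral_integrable[OF hi] le]
    unfolding integral_unique[OF gi] integral_unique[OF hi] .
  also have "\<dots> \<le> B * (2 * ln (1 + 2 * R / \<eta>) + 2)"
  proof -
    have "arsinh (Y / \<eta>) \<le> ln (1 + 2 * (Y / \<eta>))"
      using assms by (intro arsinh_le_ln) auto
    also have "\<dots> \<le> ln (1 + 2 * R / \<eta>)"
      using assms by (intro ln_mono) (auto simp: divide_simps intro!: add_pos_nonneg)
    finally show ?thesis using Bpos assms \<open>R > 0\<close>
      by (intro mult_left_mono add_mono) (auto simp: divide_simps)
  qed
  finally show ?thesis unfolding I_def by (simp add: norm_mult)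
qed

text \<open>Newman's contour: the kernel \<open>1 / w + w / R\<^sup>2\<close> equals \<open>2 Re w / R\<^sup>2\<close> on the circle, which
  compensates the growth of \<open>P\<close> on the left arc and of \<open>F - P\<close> on the right one; on the right arc
  \<open>F\<close> itself is moved to the chord.\<close>

lemma Newman_contour_bound:
  assumes P: "P holomorphic_on UNIV" and F: "F holomorphic_on {w. Re w > 0}"
    and \<eta>: "0 < \<eta>" "\<eta> < R" and E: "E \<ge> 0"
    and left: "\<And>w. cmod w = R \<Longrightarrow> Re w \<le> \<eta> \<Longrightarrow> \<bar>Re w\<bar> * cmod (P w) \<le> E"
    and right: "\<And>w. cmod w = R \<Longrightarrow> Re w \<ge> \<eta> \<Longrightarrow> Re w * cmod (F w - P w) \<le> E"
    and chord: "\<And>w. Re w = \<eta> \<Longrightarrow> cmod (F w) \<le> B"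
  shows "cmod (P 0) \<le> 2 * E / R + B * (ln (1 + 2 * R / \<eta>) + 1)"
proof -
  have R: "R > 0" using \<eta> by simp
  define G where "G = (\<lambda>w::complex. 1 / w + w / of_real (R\<^sup>2))"
  define \<alpha> where "\<alpha> = arccos (\<eta> / R)"
  have "cos \<alpha> = \<eta> / R" using \<eta> R unfolding \<alpha>_def by (intro cos_arccos) (auto simp: divide_simps)
  then have cos: "R * cos \<alpha> = \<eta>" using R by simp
  have "\<alpha> \<noteq> 0" using cos \<eta> by auto
  have "- 1 < \<eta> / R" using \<eta> R by (rule_tac less_trans[of _ 0]) auto
  then have \<alpha>: "0 < \<alpha>" "\<alpha> < pi / 2"
    using arccos_lt_bounded[of "\<eta> / R"] arccos_less_arccos[of 0 "\<eta> / R"] \<eta> R unfolding \<alpha>_def by auto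
  define Y where "Y = R * sin \<alpha>"
  have Y: "Y > 0" using \<alpha> R sin_gt_zero[of \<alpha>] by (simp add: Y_def)
  have sq: "\<eta>\<^sup>2 + Y\<^sup>2 = R\<^sup>2"
    unfolding Y_def cos[symmetric] power_mult_distrib distrib_left[symmetric] by simp
  have "Y\<^sup>2 \<le> R\<^sup>2" unfolding sq[symmetric] by simp
  then have YR: "Y \<le> R" by (rule power2_le_imp_le) (use R in simp)
  have Gcirc: "G w = of_real (2 * Re w / R\<^sup>2)" if "cmod w = R" for w
    unfolding G_def using that R by (rule Newman_kernel_on_circle)
  have PG: "continuous_on (sphere 0 R) (\<lambda>w. P w * G w)"
    unfolding G_def using R
    by (intro continuous_intros holomorphic_on_imp_continuous_on holomorphic_on_subset[OF P]) auto
  let ?L = "part_circlepath 0 R \<alpha> (2 * pi - \<alpha>)" and ?Q = "part_circlepath 0 R (-\<alpha>) \<alpha>"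
  have circ: "path_image (part_circlepath 0 R a b) \<subseteq> sphere 0 R" for a b
    using path_image_part_circlepath_subset'[of R 0 a b] R by simp
  have "((\<lambda>w. P w * (1 + w\<^sup>2 / of_real (R\<^sup>2)) / (w - 0)) has_contour_integral
      2 * of_real pi * \<i> * (P 0 * (1 + 0\<^sup>2 / of_real (R\<^sup>2)))) (circlepath 0 R)"
    using R by (intro Cauchy_integral_circlepath_simple holomorphic_intros holomorphic_on_subset[OF P]) auto
  moreover have "P w * (1 + w\<^sup>2 / of_real (R\<^sup>2)) / (w - 0) = P w * G w" if "w \<in> path_image (circlepath 0 R)" for w
    using that R by (auto simp: G_def field_simps power2_eq_square)
  ultimately have "((\<lambda>w. P w * G w) has_contour_integral
      2 * of_real pi * \<i> * (P 0 * (1 + 0\<^sup>2 / of_real (R\<^sup>2)))) (circlepath 0 R)"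
    by (rule has_contour_integral_eq)
  then have "2 * of_real pi * \<i> * P 0 = contour_integral (circlepath 0 R) (\<lambda>w. P w * G w)"
    by (simp add: contour_integral_unique)
  also have "\<dots> = contour_integral ?Q (\<lambda>w. P w * G w) + contour_integral ?L (\<lambda>w. P w * G w)"
    using \<alpha> R PG by (intro contour_integral_circlepath_arcs) auto
  finally have split: "2 * of_real pi * \<i> * P 0 = contour_integral ?Q (\<lambda>w. P w * G w) + contour_integral ?L (\<lambda>w. P w * G w)" .

  have reR: "Re w \<ge> \<eta>" if w: "w \<in> path_image ?Q" for w
  proof -
    obtain x where x: "x \<in> {-\<alpha>..\<alpha>}" "w = 0 + of_real R * cis x"
      using w \<alpha> path_image_part_circlepath[of "-\<alpha>" "\<alpha>" 0 R]
      by (auto simp: cis_conv_exp)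
    have "cos \<bar>x\<bar> \<ge> cos \<alpha>" using x \<alpha> by (intro cos_monotone_0_pi_le) auto
    then show ?thesis using x R by (simp add: cos[symmetric])
  qed
  have reL: "Re w \<le> \<eta>" if w: "w \<in> path_image ?L" for w
  proof -
    obtain x where x: "x \<in> {\<alpha>..2*pi-\<alpha>}" "w = 0 + of_real R * cis x"
      using w \<alpha> path_image_part_circlepath[of "\<alpha>" "2 * pi - \<alpha>" 0 R]
      by (auto simp: cis_conv_exp)
    have "cos x \<le> cos \<alpha>"
    proof (cases "x \<le> pi")
      case False
      have "cos (2 * pi - x) \<le> cos \<alpha>" using x \<alpha> False by (intro cos_monotone_0_pi_le) auto
      then show ?thesis by simp
    qed (use x \<alpha> in \<open>auto intro!: cos_monotone_0_pi_le\<close>)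
    then show ?thesis using x R by (simp add: cos[symmetric])
  qed

  have QF: "continuous_on (path_image ?Q) (\<lambda>w. F w * G w)"
    unfolding G_def using reR \<eta> R
    by (intro continuous_intros holomorphic_on_imp_continuous_on holomorphic_on_subset[OF F]) fastforce+
  have QP: "continuous_on (path_image p) (\<lambda>w. P w * G w)" if "p = ?Q \<or> p = ?L" for p
    using that circ continuous_on_subset[OF PG] by blast
  have L_le: "cmod (contour_integral ?L (\<lambda>w. P w * G w)) \<le> 2 * E / R\<^sup>2 * R * (2 * pi - \<alpha> - \<alpha>)"
  proof (rule has_contour_integral_bound_part_circlepath)
    show "((\<lambda>w. P w * G w) has_contour_integral contour_integral ?L (\<lambda>w. P w * G w)) ?L"
      by (intro has_contour_integral_integral contour_integrable_continuous_part_circlepath QP) simp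
    fix w assume w: "w \<in> path_image ?L"
    then have "cmod w = R" using circ by fastforce
    then have "cmod (P w * G w) = 2 * (\<bar>Re w\<bar> * cmod (P w)) / R\<^sup>2"
      by (simp add: Gcirc norm_mult norm_divide norm_power)
    then show "cmod (P w * G w) \<le> 2 * E / R\<^sup>2"
      using left[OF \<open>cmod w = R\<close> reL[OF w]] by (simp add: divide_right_mono)
  qed (use E R \<alpha> in auto)
  have Q_le: "cmod (contour_integral ?Q (\<lambda>w. F w * G w - P w * G w)) \<le> 2 * E / R\<^sup>2 * R * (\<alpha> - (- \<alpha>))"
  proof (rule has_contour_integral_bound_part_circlepath)
    show "((\<lambda>w. F w * G w - P w * G w) has_contour_integral contour_integral ?Q (\<lambda>w. F w * G w - P w * G w)) ?Q"
      by (intro has_contour_integral_integral contour_integrable_continuous_part_circlepath continuous_intros QP QF) simp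
    fix w assume w: "w \<in> path_image ?Q"
    then have "cmod w = R" using circ by fastforce
    then have "cmod ((F w - P w) * G w) = 2 * (Re w * cmod (F w - P w)) / R\<^sup>2"
      using reR[OF w] \<eta> by (simp add: Gcirc norm_mult norm_divide norm_power)
    then show "cmod (F w * G w - P w * G w) \<le> 2 * E / R\<^sup>2"
      using right[OF \<open>cmod w = R\<close> reR[OF w]] by (simp add: divide_right_mono left_diff_distrib)
  qed (use E R \<alpha> in auto)
  have "contour_integral ?Q (\<lambda>w. F w * G w) =
      contour_integral (linepath (Complex \<eta> (-Y)) (Complex \<eta> Y)) (\<lambda>w. F w * G w)"
  proof -
    have ends: "pathstart ?Q = Complex \<eta> (-Y)" "pathfinish ?Q = Complex \<eta> Y"
      by (auto simp: complex_eq_iff Y_def cos Re_exp Im_exp)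
    have conv: "convex {w. Re w > 0}" by (rule convex_halfspace_Re_gt)
    have seg: "closed_segment (Complex \<eta> Y) (Complex \<eta> (-Y)) \<subseteq> {w. Re w > 0}"
      using \<eta> by (intro closed_segment_subset conv) auto
    have hol: "(\<lambda>w. F w * G w) holomorphic_on {w. Re w > 0}"
      unfolding G_def using R by (intro holomorphic_intros F) auto
    have int: "((\<lambda>w. F w * G w) has_contour_integral 0) (?Q +++ linepath (Complex \<eta> Y) (Complex \<eta> (-Y)))"
    proof (rule Cauchy_theorem_convex_simple[OF hol conv])
      show "path_image (?Q +++ linepath (Complex \<eta> Y) (Complex \<eta> (-Y))) \<subseteq> {w. Re w > 0}"
        using seg reR \<eta> by (subst path_image_join) (use ends in \<open>fastforce+\<close>)
    qed (use ends in \<open>auto intro!: valid_path_join\<close>)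
    have "contour_integral (?Q +++ linepath (Complex \<eta> Y) (Complex \<eta> (-Y))) (\<lambda>w. F w * G w) =
        contour_integral ?Q (\<lambda>w. F w * G w) + contour_integral (linepath (Complex \<eta> Y) (Complex \<eta> (-Y))) (\<lambda>w. F w * G w)"
      using ends QF seg
      by (intro contour_integral_join contour_integrable_continuous_part_circlepath contour_integrable_continuous_linepath)
         (auto intro!: continuous_on_subset[OF holomorphic_on_imp_continuous_on[OF hol]])
    moreover have "contour_integral (linepath (Complex \<eta> Y) (Complex \<eta> (-Y))) (\<lambda>w. F w * G w)
       = - contour_integral (linepath (Complex \<eta> (-Y)) (Complex \<eta> Y)) (\<lambda>w. F w * G w)"
      using contour_integral_reversepath[of "linepath (Complex \<eta> (-Y)) (Complex \<eta> Y)"] by simp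
    ultimately show ?thesis using contour_integral_unique[OF int] by simp
  qed
  then have chord_le: "cmod (contour_integral ?Q (\<lambda>w. F w * G w)) \<le> B * (2 * ln (1 + 2 * R / \<eta>) + 2)"
    unfolding G_def using norm_chord_integral_le[OF \<eta>(1) _ YR _ sq F chord] \<eta> Y by simp
  have "contour_integral ?Q (\<lambda>w. P w * G w) = contour_integral ?Q (\<lambda>w. F w * G w)
       - contour_integral ?Q (\<lambda>w. F w * G w - P w * G w)"
    by (subst contour_integral_diff)
      (auto intro!: contour_integrable_continuous_part_circlepath QP QF)
  then have "cmod (2 * of_real pi * \<i> * P 0) \<le> B * (2 * ln (1 + 2 * R / \<eta>) + 2)
      + 2 * E / R\<^sup>2 * R * (\<alpha> - (- \<alpha>)) + 2 * E / R\<^sup>2 * R * (2 * pi - \<alpha> - \<alpha>)"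
    unfolding split using chord_le L_le Q_le
    by (smt (verit) norm_triangle_ineq norm_triangle_ineq4)
  \<comment> \<open>The opening angles of the two arcs add up to a full turn, so \<alpha>
    cancels.\<close>
  also have "\<dots> = 2 * B * (ln (1 + 2 * R / \<eta>) + 1) + 2 * pi * (2 * E / R)"
    using R by (simp add: field_simps power2_eq_square)
  also have "\<dots> \<le> 2 * pi * (B * (ln (1 + 2 * R / \<eta>) + 1)) + 2 * pi * (2 * E / R)"
  proof -
    have "B \<ge> 0" using chord[of "of_real \<eta>"] norm_ge_zero order_trans by (metis Re_complex_of_real)
    moreover have "ln (1 + 2 * R / \<eta>) \<ge> 0" using \<eta> R by simp
    ultimately have "B * (ln (1 + 2 * R / \<eta>) + 1) \<ge> 0" by simp
    from mult_right_mono[OF less_imp_le[OF pi_gt3] this] this show ?thesis by simp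
  qed
  finally have "2 * pi * cmod (P 0) \<le> 2 * pi * (B * (ln (1 + 2 * R / \<eta>) + 1) + 2 * E / R)"
    by (simp add: norm_mult distrib_left)
  then have "cmod (P 0) \<le> B * (ln (1 + 2 * R / \<eta>) + 1) + 2 * E / R" by simp
  then show ?thesis by simp
qed

section \<open>Dirichlet series in the right half-plane\<close>

lemma summation_by_parts:
  fixes t \<beta> :: "nat \<Rightarrow> 'a::comm_ring"
  shows "(\<Sum>n<M. t n * \<beta> n) =
    (\<Sum>n<M. t n) * \<beta> M + (\<Sum>n<M. (\<Sum>k<Suc n. t k) * (\<beta> n - \<beta> (Suc n)))"
  by (induction M) (simp_all add: algebra_simps)

lemma norm_one_minus_exp_le:
  assumes "Re u \<ge> 0"
  shows "cmod (1 - exp (- u)) \<le> cmod u"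
proof -
  have "cmod (exp 0 - exp (-u)) \<le> 1 * cmod (0 - (-u))"
  proof (rule field_differentiable_bound[where S = "{z. Re z \<le> 0}" and f' = exp])
    show "convex {z. Re z \<le> 0}" by (rule convex_halfspace_Re_le)
    show "cmod (exp z) \<le> 1" if "z \<in> {z. Re z \<le> 0}" for z using that by simp
  qed (use assms in \<open>auto intro: DERIV_exp[THEN DERIV_subset]\<close>)
  then show ?thesis by simp
qed

lemma norm_of_nat_Suc_powr: "cmod (of_nat (Suc n) powr z) = real (Suc n) powr Re z"
  using norm_powr_real_powr[of "of_nat (Suc n)" z] by simp

text \<open>The quotient of consecutive terms is \<open>exp (- (w * L))\<close> with
  \<open>L\<close> of order \<open>1 / n\<close>. Summation by parts thereby gains a full power of
  \<open>n\<close>, which turns conditional into absolute convergence.\<close>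

lemma norm_powr_diff_Suc_le:
  assumes "Re w \<ge> 0"
  shows "cmod (of_nat (Suc n) powr (- w) - of_nat (Suc (Suc n)) powr (- w))
    \<le> cmod w * real (Suc n) powr (- 1 - Re w)"
proof -
  define L where "L = ln (real (Suc (Suc n))) - ln (real (Suc n))"
  have L: "L \<ge> 0" unfolding L_def by simp
  have "L = ln (1 + 1 / real (Suc n))"
  proof -
    have "1 + 1 / real (Suc n) = real (Suc (Suc n)) / real (Suc n)" by (simp add: field_simps)
    then show ?thesis unfolding L_def by (simp add: ln_div del: of_nat_Suc)
  qed
  also have "\<dots> \<le> 1 / real (Suc n)"
    by (rule ln_add_one_self_le_self) simp
  finally have L1: "L \<le> 1 / real (Suc n)" .
  have "of_nat (Suc (Suc n)) powr (- w) = of_nat (Suc n) powr (- w) * exp (- (w * of_real L))"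
    unfolding powr_def L_def of_real_diff
    by (simp add: Ln_of_nat exp_add[symmetric] algebra_simps del: of_nat_Suc)
  then have "of_nat (Suc n) powr (- w) - of_nat (Suc (Suc n)) powr (- w)
      = of_nat (Suc n) powr (- w) * (1 - exp (- (w * of_real L)))"
    by (simp add: algebra_simps)
  then have "cmod (of_nat (Suc n) powr (- w) - of_nat (Suc (Suc n)) powr (- w))
      = real (Suc n) powr (- Re w) * cmod (1 - exp (- (w * of_real L)))"
    by (simp only: norm_mult norm_of_nat_Suc_powr uminus_complex.sel)
  also have "\<dots> \<le> real (Suc n) powr (- Re w) * cmod (w * of_real L)"
    using assms L by (intro mult_left_mono norm_one_minus_exp_le) auto
  also have "\<dots> \<le> real (Suc n) powr (- Re w) * (cmod w * (1 / real (Suc n)))"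
    using L mult_left_mono[OF L1 norm_ge_zero[of w]]
    by (intro mult_left_mono) (simp_all add: norm_mult del: of_nat_Suc)
  also have "\<dots> = cmod w * real (Suc n) powr (- 1 - Re w)"
    by (simp add: powr_diff powr_minus field_simps del: of_nat_Suc)
  finally show ?thesis .
qed

section \<open>Partial sums of Dirichlet series and holomorphy of the sum\<close>

definition dirichlet_term :: "(nat \<Rightarrow> complex) \<Rightarrow> nat \<Rightarrow> complex \<Rightarrow> complex"
  where "dirichlet_term a n s = a (Suc n) * of_nat (Suc n) powr (- s)"

text \<open>Because of the shift in \<open>dirichlet_term\<close>, the last coefficient used is the
  one of index \<open>N\<close>, and \<open>a 0\<close> is never read.\<close>

definition dirichlet_sum :: "(nat \<Rightarrow> complex) \<Rightarrow> nat \<Rightarrow> complex \<Rightarrow> complex"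
  where "dirichlet_sum a N s = (\<Sum>n<N. dirichlet_term a n s)"

lemma dirichlet_term_add:
  "dirichlet_term a n (s + w) = dirichlet_term a n s * of_nat (Suc n) powr (- w)"
  by (simp add: dirichlet_term_def powr_diff powr_minus field_simps del: of_nat_Suc)

lemma norm_dirichlet_term:
  "cmod (dirichlet_term a n s) = cmod (a (Suc n)) * real (Suc n) powr (- Re s)"
  by (simp add: dirichlet_term_def norm_mult norm_of_nat_Suc_powr del: of_nat_Suc)

lemma holomorphic_dirichlet_term: "dirichlet_term a n holomorphic_on A"
  unfolding dirichlet_term_def by (intro holomorphic_intros)

lemma holomorphic_dirichlet_sum: "dirichlet_sum a N holomorphic_on A"
  unfolding dirichlet_sum_def by (intro holomorphic_intros holomorphic_dirichlet_term)

lemma tendsto_of_nat_Suc_powr_zero: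
  assumes "Re w > 0"
  shows "(\<lambda>n. of_nat (Suc n) powr (- w)) \<longlonglongrightarrow> (0::complex)"
proof (rule tendsto_norm_zero_cancel)
  have "(\<lambda>n. real (Suc n) powr (- Re w)) \<longlonglongrightarrow> 0"
    using assms by real_asymp
  then show "(\<lambda>n. cmod (of_nat (Suc n) powr (- w))) \<longlonglongrightarrow> 0"
    by (simp add: norm_of_nat_Suc_powr del: of_nat_Suc)
qed

text \<open>Convergence at the real point \<delta> = Re s0 / 2 bounds the partial sums there.
  Summation by parts against these rewrites the series to the right of \<delta> as a locally
  dominated one, to which the comparison theorem for complex differentiable series applies.\<close>

lemma dirichlet_series_holomorphic:
  assumes sums: "\<And>s. s \<in> halfplane 0 \<Longrightarrow> (\<lambda>n. dirichlet_term a n s) sums f s"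
  shows "f holomorphic_on halfplane 0"
proof -
  have "f field_differentiable (at s0)" if s0: "s0 \<in> halfplane 0" for s0
  proof -
    define \<delta> where "\<delta> = Re s0 / 2"
    have \<delta>: "\<delta> > 0" using s0 by (simp add: \<delta>_def halfplane_def)
    define S where "S = {s. Re s > \<delta>}"
    have S: "open S" unfolding S_def by (rule open_halfspace_Re_gt)
    have "s0 \<in> S" using \<delta> by (simp add: S_def \<delta>_def)
    define P where "P = (\<lambda>n. dirichlet_sum a n (of_real \<delta>))"
    have "P \<longlonglongrightarrow> f (of_real \<delta>)"
      using sums[of "of_real \<delta>"] \<delta> unfolding sums_def P_def dirichlet_sum_def by (simp add: halfplane_def)
    then have "Bseq P" by (rule convergentI[THEN convergent_imp_Bseq])
    then obtain B where B: "B > 0" "\<And>n. cmod (P n) \<le> B" by (auto elim: BseqE)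
    define \<beta> where "\<beta> = (\<lambda>s n. of_nat (Suc n) powr (- (s - of_real \<delta>)) :: complex)"
    define g where "g = (\<lambda>n s. P (Suc n) * (\<beta> s n - \<beta> s (Suc n)))"
    have gsums: "(\<lambda>n. g n s) sums f s" if "s \<in> S" for s
    proof -
      have s: "Re s > \<delta>" using that by (simp add: S_def)
      have eq: "(\<Sum>n<M. dirichlet_term a n s) = P M * \<beta> s M + (\<Sum>n<M. g n s)" for M
      proof -
        have "(\<Sum>n<M. dirichlet_term a n s) = (\<Sum>n<M. dirichlet_term a n (of_real \<delta>) * \<beta> s n)"
          using dirichlet_term_add[of a _ "of_real \<delta>" "s - of_real \<delta>"] by (simp add: \<beta>_def)
        also have "\<dots> = P M * \<beta> s M + (\<Sum>n<M. g n s)"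
          by (subst summation_by_parts) (simp only: g_def P_def dirichlet_sum_def)
        finally show ?thesis .
      qed
      have "\<beta> s \<longlonglongrightarrow> 0" unfolding \<beta>_def using s by (intro tendsto_of_nat_Suc_powr_zero) simp
      then have "(\<lambda>M. P M * \<beta> s M) \<longlonglongrightarrow> 0"
        using \<open>Bseq P\<close> bounded_bilinear.Bfun_prod_Zfun[OF bounded_bilinear_mult]
        by (simp add: tendsto_Zfun_iff)
      moreover have "(\<lambda>M. \<Sum>n<M. dirichlet_term a n s) \<longlonglongrightarrow> f s"
        using sums[of s] s \<delta> unfolding sums_def by (simp add: halfplane_def)
      ultimately have "(\<lambda>M. (\<Sum>n<M. dirichlet_term a n s) - P M * \<beta> s M) \<longlonglongrightarrow> f s - 0"
        by (intro tendsto_diff)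
      then show ?thesis unfolding sums_def by (simp add: eq)
    qed
    obtain G where G: "\<forall>x\<in>S. ((\<lambda>n. g n x) sums G x) \<and> G field_differentiable (at x)"
    proof (rule series_differentiable_comparison_complex[OF S, of g])
      show "g n field_differentiable (at x)" if "x \<in> S" for n x
      proof -
        have "g n holomorphic_on S" unfolding g_def \<beta>_def by (intro holomorphic_intros)
        then show ?thesis using that S by (simp add: holomorphic_on_imp_differentiable_at)
      qed
      fix x assume x: "x \<in> S"
      \<comment> \<open>Half the distance of \<open>x\<close> from the boundary of \<open>S\<close>:
        on the ball of radius \<open>d\<close> the exponent stays at least \<open>d\<close> to the
        right of \<delta>.\<close>
      define d where "d = (Re x - \<delta>) / 2"
      have d: "d > 0" using x by (simp add: d_def S_def)
      define h where "h = (\<lambda>n. of_real (B * ((cmod x + d + \<delta>) * real (Suc n) powr (- 1 - d))) :: complex)"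
      have "summable (\<lambda>n. real (Suc n) powr (- 1 - d))"
        using d by (subst summable_Suc_iff) (auto simp: summable_real_powr_iff)
      then have "summable h" unfolding h_def
        by (intro summable_of_real summable_mult)
      moreover have "range h \<subseteq> \<real>\<^sub>\<ge>\<^sub>0" using B d \<delta> by (auto simp: h_def simp del: of_real_mult)
      moreover have "\<forall>n. \<forall>y\<in>ball x d \<inter> S. cmod (g n y) \<le> cmod (h n)"
      proof safe
        fix n y assume y: "y \<in> ball x d" "y \<in> S"
        define w where "w = y - of_real \<delta>"
        have "\<bar>Re x - Re y\<bar> < d" using y abs_Re_le_cmod[of "x - y"] by (simp add: dist_norm)
        then have Rew: "Re w \<ge> d" unfolding w_def d_def by (simp add: field_simps abs_if split: if_splits)
        have "cmod w \<le> cmod y + \<delta>" unfolding w_def using norm_triangle_ineq4[of y "of_real \<delta>"] \<delta> by simp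
        moreover have "cmod y \<le> cmod x + d" using y norm_triangle_ineq3[of x y] by (simp add: dist_norm)
        ultimately have cw: "cmod w \<le> cmod x + d + \<delta>" by simp
        have "cmod (\<beta> y n - \<beta> y (Suc n)) \<le> cmod w * real (Suc n) powr (- 1 - Re w)"
          unfolding \<beta>_def w_def[symmetric] using Rew d by (intro norm_powr_diff_Suc_le) simp
        also have "\<dots> \<le> (cmod x + d + \<delta>) * real (Suc n) powr (- 1 - d)"
          using cw Rew d \<delta> by (intro mult_mono powr_mono) auto
        finally have "cmod (g n y) \<le> B * ((cmod x + d + \<delta>) * real (Suc n) powr (- 1 - d))"
          unfolding g_def norm_mult using B by (intro mult_mono) (auto intro: less_imp_le)
        also have "\<dots> = cmod (h n)" unfolding h_def norm_of_real using B d \<delta> by simp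
        finally show "cmod (g n y) \<le> cmod (h n)" .
      qed
      ultimately show "\<exists>d h. 0 < d \<and> summable h \<and> range h \<subseteq> \<real>\<^sub>\<ge>\<^sub>0 \<and>
          (\<forall>\<^sub>F n in sequentially. \<forall>y\<in>ball x d \<inter> S. cmod (g n y) \<le> cmod (h n))"
        using d by (intro exI[of _ d] exI[of _ h]) (auto intro!: always_eventually)
    qed (rule that)
    have "G x = f x" if "x \<in> S" for x using G gsums that sums_unique2 by blast
    then show ?thesis
      using G \<open>s0 \<in> S\<close> S unfolding field_differentiable_def
      by (meson has_field_derivative_transform_within_open)
  qed
  then show ?thesis
    by (auto simp: holomorphic_on_def intro: field_differentiable_at_within)
qed

section \<open>A polynomial bound for the coefficients\<close>

text \<open>A discrete mean value formula: averaging \<open>f\<close> times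
  \<open>(n + 1) powr s\<close> over equidistant points of the line \<open>Re s = 2\<close> isolates
  one coefficient, provided the spacing \<open>h\<close> resonates with no other frequency. The
  exponent 2 in the bound is the abscissa of that line, chosen so that the series converges
  absolutely there.\<close>

lemma dirichlet_coefficient_bound:
  assumes sums: "\<And>s. s \<in> halfplane 0 \<Longrightarrow> (\<lambda>n. dirichlet_term a n s) sums f s"
    and bound: "\<And>s. s \<in> halfplane 0 \<Longrightarrow> cmod (f s) \<le> K"
  shows "cmod (a (Suc n)) \<le> K * (real (Suc n))\<^sup>2"
proof -
  define l where "l = (\<lambda>m. ln (real (Suc m)) - ln (real (Suc n)))"
  \<comment> \<open>The spacings for which \<open>h * l m\<close> is a multiple of 2 pi for some
    \<open>m\<close>. Where \<open>l n = 0\<close>, division by zero contributes only the value 0,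
    so the set is countable.\<close>
  define bad where "bad = (\<Union>m. range (\<lambda>j::int. 2 * pi * of_int j / l m))"
  have "countable bad" unfolding bad_def by auto
  then have "bad \<noteq> UNIV" using uncountable_UNIV_real by metis
  then obtain h where h: "h \<notin> bad" by blast
  define z where "z = (\<lambda>m. exp (- (\<i> * of_real (h * l m))))"
  have z1: "cmod (z m) = 1" for m by (simp add: z_def)
  have zn: "z n = 1" by (simp add: z_def l_def)
  have zne: "z m \<noteq> 1" if "m \<noteq> n" for m
  proof
    assume "z m = 1"
    then obtain j :: int where "- (h * l m) = of_int (2 * j) * pi"
      unfolding z_def exp_eq_1 by auto
    moreover have "l m \<noteq> 0" using that by (simp add: l_def)
    ultimately have "h = 2 * pi * of_int (- j) / l m" by (simp add: field_simps)
    then show False using h unfolding bad_def by blast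
  qed
  define c where "c = (\<lambda>m. dirichlet_term a m 2 * of_nat (Suc n) powr 2)"
  define A where "A = (\<lambda>m k. (\<Sum>j<k. z m ^ j) / of_nat k)"
  have A_le: "cmod (A m k) \<le> 1" for m k
  proof -
    have "cmod (\<Sum>j<k. z m ^ j) \<le> (\<Sum>j<k. 1)"
      by (rule sum_norm_le) (simp add: norm_power z1)
    then show ?thesis by (cases "k = 0") (simp_all add: A_def norm_divide)
  qed
  have A_lim: "A m \<longlonglongrightarrow> (if m = n then 1 else 0)" for m
  proof (cases "m = n")
    case True
    have "(\<lambda>k. of_nat k / of_nat k :: complex) \<longlonglongrightarrow> 1"
      by (rule tendsto_eventually) (auto simp: eventually_at_top_linorder intro!: exI[of _ 1])
    then show ?thesis using True by (simp add: A_def zn)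
  next
    case False
    have "cmod (A m k) \<le> (2 / cmod (z m - 1)) * (1 / real k)" for k
    proof -
      have "cmod (z m ^ k - 1) \<le> 2"
        using norm_triangle_ineq4[of "z m ^ k" 1] by (simp add: norm_power z1)
      then have "cmod (z m ^ k - 1) / (cmod (z m - 1) * real k) \<le> 2 / (cmod (z m - 1) * real k)"
        by (rule divide_right_mono) simp
      then show ?thesis
        using zne[OF False] by (simp add: A_def geometric_sum norm_divide norm_mult)
    qed
    moreover have "(\<lambda>k. (2 / cmod (z m - 1)) * (1 / real k)) \<longlonglongrightarrow> 0"
      by (intro tendsto_mult_right_zero lim_1_over_n)
    ultimately have "A m \<longlonglongrightarrow> 0"
      by (rule Lim_null_comparison[OF always_eventually[OF allI]])
    then show ?thesis using False by simp
  qed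
  \<comment> \<open>The terms are bounded at 1/2, and moving to 2 multiplies them by
    \<open>(m + 1) powr (- 3 / 2)\<close>. This is the majorant for Tannery's theorem.\<close>
  have csum: "summable (\<lambda>m. cmod (c m))"
  proof -
    have "(\<lambda>m. dirichlet_term a m (of_real (1/2))) \<longlonglongrightarrow> 0"
      by (rule sums_summable[OF sums, THEN summable_LIMSEQ_zero]) (simp add: halfplane_def)
    then have "Bseq (\<lambda>m. dirichlet_term a m (of_real (1/2)))" by (rule convergentI[THEN convergent_imp_Bseq])
    then obtain B where B: "B > 0" "\<And>m. cmod (dirichlet_term a m (of_real (1/2))) \<le> B" by (auto elim: BseqE)
    have "summable (\<lambda>m. real (Suc m) powr (- 3 / 2))"
      by (subst summable_Suc_iff) (auto simp: summable_real_powr_iff)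
    then have "summable (\<lambda>m. B * real (Suc m) powr (- 3 / 2))" by (rule summable_mult)
    then have "summable (\<lambda>m. cmod (dirichlet_term a m 2))"
    proof (rule summable_comparison_test'[where N = 0])
      fix m
      show "norm (cmod (dirichlet_term a m 2)) \<le> B * real (Suc m) powr (- 3 / 2)"
        using mult_right_mono[OF B(2)[of m], of "real (Suc m) powr (- 3 / 2)"]
          dirichlet_term_add[of a m "of_real (1/2)" "of_real (3/2)"]
        by (simp add: norm_mult norm_of_nat_Suc_powr del: of_nat_Suc)
    qed
    then show ?thesis unfolding c_def norm_mult by (rule summable_mult2)
  qed
  define w where "w = (\<lambda>j. 2 + \<i> * of_real (real j * h))"
  have w: "w j \<in> halfplane 0" for j by (simp add: w_def halfplane_def)
  have term_eq: "dirichlet_term a m (w j) * of_nat (Suc n) powr (w j) = c m * z m ^ j" for m j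
  proof -
    have "dirichlet_term a m (w j) = dirichlet_term a m 2 * of_nat (Suc m) powr (- (\<i> * of_real (real j * h)))"
      unfolding w_def by (rule dirichlet_term_add)
    moreover have "of_nat (Suc n) powr (w j) = of_nat (Suc n) powr 2 * of_nat (Suc n) powr (\<i> * of_real (real j * h))"
      unfolding w_def by (rule powr_add)
    moreover have "of_nat (Suc m) powr (- (\<i> * of_real (real j * h))) * of_nat (Suc n) powr (\<i> * of_real (real j * h)) = z m ^ j"
      unfolding z_def l_def powr_def exp_of_nat_mult[symmetric]
      by (simp add: Ln_of_nat exp_add[symmetric] algebra_simps del: of_nat_Suc)
    ultimately show ?thesis by (simp add: c_def mult_ac)
  qed
  have avg: "(\<lambda>m. c m * A m k) sums ((\<Sum>j<k. f (w j) * of_nat (Suc n) powr (w j)) / of_nat k)" for k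
  proof -
    have "(\<lambda>m. \<Sum>j<k. dirichlet_term a m (w j) * of_nat (Suc n) powr (w j)) sums (\<Sum>j<k. f (w j) * of_nat (Suc n) powr (w j))"
      by (intro sums_sum sums_mult2 sums w)
    then have "(\<lambda>m. (\<Sum>j<k. c m * z m ^ j) / of_nat k) sums ((\<Sum>j<k. f (w j) * of_nat (Suc n) powr (w j)) / of_nat k)"
      unfolding term_eq by (rule sums_divide)
    then show ?thesis by (simp add: A_def sum_distrib_left)
  qed
  have "((\<lambda>k. suminf (\<lambda>m. c m * A m k)) \<longlongrightarrow> suminf (\<lambda>m. c m * (if m = n then 1 else 0))) sequentially"
    using A_le csum
    by (intro tannerys_theorem[where M = "\<lambda>m. cmod (c m)", THEN conjunct2, THEN conjunct2] tendsto_intros A_lim)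
      (auto intro!: always_eventually mult_left_le simp: norm_mult)
  also have "suminf (\<lambda>m. c m * (if m = n then 1 else 0)) = c n"
    using sums_If_finite_set[of "{n}" c] by (simp add: sums_iff if_distrib cong: if_cong)
  also have "c n = a (Suc n)"
    by (simp add: c_def dirichlet_term_def powr_minus field_simps del: of_nat_Suc)
  finally have lim: "(\<lambda>k. \<Sum>m. c m * A m k) \<longlonglongrightarrow> a (Suc n)" .
  have "cmod (\<Sum>m. c m * A m k) \<le> K * (real (Suc n))\<^sup>2" for k
  proof -
    have "K \<ge> 0" using bound[OF w[of 0]] norm_ge_zero order_trans by blast
    have "cmod (\<Sum>j<k. f (w j) * of_nat (Suc n) powr (w j)) \<le> (\<Sum>j<k. K * (real (Suc n))\<^sup>2)"
    proof (rule sum_norm_le)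
      fix j
      have "cmod (of_nat (Suc n) powr (w j)) = (real (Suc n))\<^sup>2"
        by (simp add: norm_of_nat_Suc_powr w_def del: of_nat_Suc)
      then show "cmod (f (w j) * of_nat (Suc n) powr (w j)) \<le> K * (real (Suc n))\<^sup>2"
        using bound[OF w[of j]] by (simp add: norm_mult mult_right_mono del: of_nat_Suc)
    qed
    then show ?thesis using \<open>K \<ge> 0\<close> unfolding sums_unique[OF avg[of k], symmetric]
      by (cases "k = 0") (simp_all add: norm_divide divide_le_eq mult_ac del: of_nat_Suc)
  qed
  then show ?thesis by (intro Lim_norm_ubound[OF _ lim]) auto
qed

section \<open>Partial sums of bounded Dirichlet series\<close>

text \<open>From \<open>q \<le> exp (- (1 - q))\<close> and \<open>z * exp (- z) \<le> 1\<close>. It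
  lets the exponential decay of a single term absorb the factor \<open>Re w\<close> produced by the
  kernel.\<close>

lemma mult_powr_le_inverse:
  fixes q y :: real
  assumes "0 < q" "q < 1" "y \<ge> 0"
  shows "y * q powr y \<le> 1 / (1 - q)"
proof -
  define z where "z = y * (1 - q)"
  have z: "z \<ge> 0" unfolding z_def using assms by (intro mult_nonneg_nonneg) auto
  have "y * ln q \<le> y * (q - 1)" using assms by (intro mult_left_mono ln_le_minus_one) auto
  then have "q powr y \<le> exp (- z)" using assms by (simp add: powr_def z_def algebra_simps)
  then have "z * q powr y \<le> z * exp (- z)" using z by (rule mult_left_mono)
  also have "\<dots> \<le> 1"
  proof -
    have "z \<le> exp z" using exp_ge_add_one_self[of z] by linarith
    then show ?thesis by (simp add: exp_minus field_simps)
  qed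
  finally show ?thesis using assms by (simp add: z_def field_simps)
qed

lemma norm_dirichlet_sum_le:
  assumes coeff: "\<And>n. cmod (a (Suc n)) \<le> (real (Suc n))\<^sup>2" and s: "Re s \<ge> 0"
  shows "cmod (dirichlet_sum a N s) \<le> real N ^ 3"
proof -
  have "cmod (dirichlet_term a n s) \<le> (real N)\<^sup>2" if "n < N" for n
  proof -
    have "real (Suc n) powr (- Re s) \<le> real (Suc n) powr 0"
      using s by (intro powr_mono) auto
    then have "cmod (dirichlet_term a n s) \<le> (real (Suc n))\<^sup>2 * 1"
      unfolding norm_dirichlet_term using coeff[of n] by (intro mult_mono) auto
    also have "\<dots> \<le> (real N)\<^sup>2" using that by (simp add: power_mono del: of_nat_Suc)
    finally show ?thesis .
  qed
  then have "cmod (dirichlet_sum a N s) \<le> (\<Sum>n<N. (real N)\<^sup>2)"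
    unfolding dirichlet_sum_def by (intro sum_norm_le) auto
  then show ?thesis by (simp add: power2_eq_square power3_eq_cube mult_ac)
qed

text \<open>The cut-off point \<open>N + 1/2\<close> keeps both \<open>n / (N + 1/2)\<close> for \<open>n \<le> N\<close> and \<open>(N + 1/2) / n\<close>
  for \<open>n > N\<close> away from \<open>1\<close>.\<close>

lemma norm_dirichlet_sum_left_le:
  assumes coeff: "\<And>n. cmod (a (Suc n)) \<le> (real (Suc n))\<^sup>2" and s: "Re s \<ge> 0"
    and x0: "x0 = real N + 1 / 2" and N: "N \<ge> 1" and w: "Re w \<le> 1"
  shows "\<bar>Re w\<bar> * cmod (dirichlet_sum a N (s + w) * of_real x0 powr w) \<le> 2 * x0 ^ 4"
proof -
  have x0pos: "x0 \<ge> 1" using x0 N by simp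
  have term_le: "\<bar>Re w\<bar> * (cmod (dirichlet_term a n (s + w)) * x0 powr Re w) \<le> (real N)\<^sup>2 * (2 * x0)" if n: "n < N" for n
  proof -
    define m where "m = real (Suc n)"
    have m: "m \<ge> 1" "m \<le> real N" using n by (auto simp: m_def)
    have "cmod (dirichlet_term a n (s + w)) * x0 powr Re w
        = cmod (a (Suc n)) * m powr (- Re s) * (x0 / m) powr Re w"
      unfolding norm_dirichlet_term m_def[symmetric] using m x0pos
      by (simp add: powr_diff powr_minus powr_divide field_simps)
    also have "\<dots> \<le> m\<^sup>2 * 1 * (x0 / m) powr Re w"
    proof (intro mult_right_mono mult_mono)
      have "m powr (- Re s) \<le> m powr 0" using s m by (intro powr_mono) auto
      then show "m powr (- Re s) \<le> 1" using m by simp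
    qed (use coeff[of n] in \<open>auto simp: m_def\<close>)
    finally have 1: "cmod (dirichlet_term a n (s + w)) * x0 powr Re w \<le> m\<^sup>2 * (x0 / m) powr Re w" by simp
    \<comment> \<open>For \<open>0 \<le> Re w \<le> 1\<close> the power is at most
      \<open>x0\<close>. For negative \<open>Re w\<close> it decays with ratio
      \<open>m / x0\<close>, which stays below 1 since \<open>x0 - m \<ge> 1 / 2\<close>.\<close>
    have 2: "\<bar>Re w\<bar> * (x0 / m) powr Re w \<le> 2 * x0"
    proof (cases "Re w \<ge> 0")
      case True
      have "(x0 / m) powr Re w \<le> (x0 / m) powr 1"
        using w m x0 by (intro powr_mono) auto
      also have "\<dots> \<le> x0" using m x0pos by (simp add: field_simps mult_left_le)
      finally have "\<bar>Re w\<bar> * (x0 / m) powr Re w \<le> 1 * x0"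
        using True w by (intro mult_mono) auto
      then show ?thesis using x0pos by simp
    next
      case False
      define q where "q = m / x0"
      have q: "0 < q" "q < 1" using m x0 by (auto simp: q_def)
      have "(x0 / m) powr Re w = q powr \<bar>Re w\<bar>"
        using False m x0pos by (simp add: q_def powr_divide powr_minus field_simps)
      then have "\<bar>Re w\<bar> * (x0 / m) powr Re w \<le> 1 / (1 - q)"
        using mult_powr_le_inverse[OF q] by simp
      also have "\<dots> = x0 / (x0 - m)" using x0pos by (simp add: q_def field_simps)
      also have "\<dots> \<le> x0 / (1 / 2)" using m x0 by (intro divide_left_mono) auto
      also have "\<dots> = 2 * x0" by simp
      finally show ?thesis .
    qed
    have "\<bar>Re w\<bar> * (cmod (dirichlet_term a n (s + w)) * x0 powr Re w) \<le> \<bar>Re w\<bar> * (m\<^sup>2 * (x0 / m) powr Re w)"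
      using 1 by (intro mult_left_mono) auto
    also have "\<dots> = m\<^sup>2 * (\<bar>Re w\<bar> * (x0 / m) powr Re w)" by simp
    also have "\<dots> \<le> (real N)\<^sup>2 * (2 * x0)"
      using m x0pos by (intro mult_mono[OF power_mono 2]) auto
    finally show ?thesis .
  qed
  have "\<bar>Re w\<bar> * cmod (dirichlet_sum a N (s + w) * of_real x0 powr w)
      = \<bar>Re w\<bar> * (cmod (dirichlet_sum a N (s + w)) * x0 powr Re w)"
    using x0pos by (simp add: norm_mult norm_powr_real_powr)
  also have "\<dots> \<le> \<bar>Re w\<bar> * ((\<Sum>n<N. cmod (dirichlet_term a n (s + w))) * x0 powr Re w)"
    unfolding dirichlet_sum_def by (intro mult_left_mono mult_right_mono norm_sum) auto
  also have "\<dots> = (\<Sum>n<N. \<bar>Re w\<bar> * (cmod (dirichlet_term a n (s + w)) * x0 powr Re w))"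
    by (simp add: sum_distrib_left sum_distrib_right)
  also have "\<dots> \<le> (\<Sum>n<N. (real N)\<^sup>2 * (2 * x0))"
    by (intro sum_mono term_le) simp
  also have "\<dots> = real N ^ 3 * (2 * x0)" by (simp add: power2_eq_square power3_eq_cube)
  also have "\<dots> \<le> x0 ^ 3 * (2 * x0)"
    using x0 by (intro mult_right_mono power_mono) auto
  also have "\<dots> = 2 * x0 ^ 4" by (simp add: power_numeral_reduce)
  finally show ?thesis .
qed

text \<open>Up to \<open>Re w = 4\<close> the triangle inequality suffices. Beyond that, four of the
  \<open>Re w\<close> factors \<open>q = x0 / m\<close> are set aside: together with the coefficient
  bound they give \<open>m\<^sup>2 * q ^ 4 = x0 ^ 4 / m\<^sup>2\<close>, which is summable, and the
  remaining ones compensate the factor \<open>Re w\<close>.\<close>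

lemma norm_dirichlet_tail_right_le:
  assumes sums: "\<And>s. s \<in> halfplane 0 \<Longrightarrow> (\<lambda>n. dirichlet_term a n s) sums f s"
    and bound: "\<And>s. s \<in> halfplane 0 \<Longrightarrow> cmod (f s) \<le> 1"
    and coeff: "\<And>n. cmod (a (Suc n)) \<le> (real (Suc n))\<^sup>2" and s: "Re s > 0"
    and x0: "x0 = real N + 1 / 2" and N: "N \<ge> 1" and w: "Re w > 0"
  shows "Re w * cmod (f (s + w) * of_real x0 powr w - dirichlet_sum a N (s + w) * of_real x0 powr w) \<le> 12 * x0 ^ 7"
proof -
  have x0pos: "x0 \<ge> 3/2" using x0 N by simp
  have sw: "s + w \<in> halfplane 0" using s w by (simp add: halfplane_def)
  have eq: "Re w * cmod (f (s + w) * of_real x0 powr w - dirichlet_sum a N (s + w) * of_real x0 powr w)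
      = Re w * (cmod (f (s + w) - dirichlet_sum a N (s + w)) * x0 powr Re w)"
    using x0pos by (simp add: norm_mult norm_powr_real_powr flip: left_diff_distrib)
  show ?thesis
  proof (cases "Re w \<le> 4")
    case True
    have "cmod (f (s + w) - dirichlet_sum a N (s + w)) \<le> cmod (f (s + w)) + cmod (dirichlet_sum a N (s + w))"
      by (rule norm_triangle_ineq4)
    also have "\<dots> \<le> 1 + real N ^ 3"
      using s w by (intro add_mono bound[OF sw] norm_dirichlet_sum_le coeff) auto
    also have "\<dots> \<le> x0 ^ 3 + x0 ^ 3"
      using x0 x0pos by (intro add_mono power_mono one_le_power) auto
    finally have 1: "cmod (f (s + w) - dirichlet_sum a N (s + w)) \<le> 2 * x0 ^ 3" by simp
    have "x0 powr Re w \<le> x0 powr 4" using True x0pos by (intro powr_mono) auto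
    then have 2: "x0 powr Re w \<le> x0 ^ 4" using x0pos by simp
    have "Re w * (cmod (f (s + w) - dirichlet_sum a N (s + w)) * x0 powr Re w) \<le> 4 * (2 * x0 ^ 3 * x0 ^ 4)"
      using True w x0pos by (intro mult_mono 1 2) auto
    also have "\<dots> = 8 * x0 ^ 7" by (simp flip: power_add)
    also have "\<dots> \<le> 12 * x0 ^ 7" using x0pos by simp
    finally show ?thesis unfolding eq .
  next
    case False
    \<comment> \<open>Here \<open>6 * x0\<close> dominates \<open>1 + 2 * x0 + 4\<close>, and
      \<open>x0 ^ 4\<close> comes from \<open>q ^ 4\<close>. Summing the inverse squares costs a
      factor 2, whence the 12 of the conclusion.\<close>
    define c where "c = 6 * x0 ^ 5"
    have c: "c \<ge> 0" using x0pos by (simp add: c_def)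
    have term_le: "Re w * (cmod (dirichlet_term a n (s + w)) * x0 powr Re w) \<le> c * (1 / (real (Suc n))\<^sup>2)" if n: "n \<ge> N" for n
    proof -
      define m where "m = real (Suc n)"
      have m: "m \<ge> real N + 1" using n by (auto simp: m_def)
      have mpos: "m > 0" using m by simp
      define q where "q = x0 / m"
      have q: "0 < q" "q < 1" using m x0 by (auto simp: q_def)
      have "cmod (dirichlet_term a n (s + w)) * x0 powr Re w
          = cmod (a (Suc n)) * m powr (- Re s) * (x0 / m) powr Re w"
        unfolding norm_dirichlet_term m_def[symmetric] using mpos x0pos
        by (simp add: powr_diff powr_minus powr_divide field_simps)
      also have "\<dots> \<le> m\<^sup>2 * 1 * (x0 / m) powr Re w"
      proof (intro mult_right_mono mult_mono)
        have "m powr (- Re s) \<le> m powr 0" using s m by (intro powr_mono) auto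
        then show "m powr (- Re s) \<le> 1" using mpos by simp
      qed (use coeff[of n] in \<open>auto simp: m_def\<close>)
      finally have 1: "cmod (dirichlet_term a n (s + w)) * x0 powr Re w \<le> m\<^sup>2 * q powr Re w" by (simp add: q_def)
      have "q powr Re w = q powr (Re w - 4) * q powr 4" by (simp flip: powr_add)
      also have "q powr 4 = q ^ 4" using q by simp
      finally have 2: "Re w * q powr Re w = ((Re w - 4) * q powr (Re w - 4) + 4 * q powr (Re w - 4)) * q ^ 4"
        by (simp add: algebra_simps)
      have "(Re w - 4) * q powr (Re w - 4) \<le> 1 / (1 - q)"
        using False q by (intro mult_powr_le_inverse) auto
      also have "\<dots> = m / (m - x0)" using mpos by (simp add: q_def field_simps)
      also have "\<dots> = 1 + x0 / (m - x0)" using m x0 by (simp add: field_simps)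
      also have "\<dots> \<le> 1 + x0 / (1 / 2)"
        using m x0 x0pos by (intro add_left_mono divide_left_mono) auto
      finally have 3: "(Re w - 4) * q powr (Re w - 4) \<le> 1 + 2 * x0" by simp
      have "q powr (Re w - 4) \<le> 1" using False q by (intro powr_le1) auto
      with 3 have "Re w * q powr Re w \<le> (1 + 2 * x0 + 4) * q ^ 4"
        unfolding 2 using q by (intro mult_right_mono) auto
      also have "\<dots> \<le> (6 * x0) * q ^ 4"
        using x0pos q by (intro mult_right_mono) auto
      finally have 4: "Re w * q powr Re w \<le> 6 * x0 * q ^ 4" .
      have "Re w * (cmod (dirichlet_term a n (s + w)) * x0 powr Re w) \<le> Re w * (m\<^sup>2 * q powr Re w)"
        using 1 w by (intro mult_left_mono) auto
      also have "\<dots> = m\<^sup>2 * (Re w * q powr Re w)" by simp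
      also have "\<dots> \<le> m\<^sup>2 * (6 * x0 * q ^ 4)" by (intro mult_left_mono 4) auto
      also have "\<dots> = c * (1 / m\<^sup>2)" using mpos
        by (simp add: q_def c_def power_divide field_simps power_numeral_reduce)
      finally show ?thesis unfolding m_def .
    qed
    have sq: "(\<lambda>n. 1 / (real (Suc n))\<^sup>2) sums (pi\<^sup>2 / 6)" using inverse_squares_sums by simp
    have pi: "pi\<^sup>2 / 6 \<le> 2"
    proof -
      have "pi \<le> 3.2" using pi_approx by simp
      then have "pi\<^sup>2 \<le> 3.2\<^sup>2" by (intro power_mono) auto
      then show ?thesis by (simp add: power2_eq_square)
    qed
    have cs: "summable (\<lambda>n. c * (1 / (real (Suc (n + N)))\<^sup>2))"
      using summable_ignore_initial_segment[OF sums_summable[OF sq], of N] by (rule summable_mult)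
    define v where "v = (\<lambda>n. of_real (Re w * x0 powr Re w) * dirichlet_term a (n + N) (s + w))"
    have "v sums (of_real (Re w * x0 powr Re w) * (f (s + w) - dirichlet_sum a N (s + w)))"
      unfolding v_def dirichlet_sum_def
      using sums_split_initial_segment[OF sums[OF sw], of N] by (rule sums_mult)
    then have "Re w * (cmod (f (s + w) - dirichlet_sum a N (s + w)) * x0 powr Re w) = cmod (suminf v)"
      using w by (simp add: sums_iff norm_mult)
    also have "\<dots> \<le> (\<Sum>n. c * (1 / (real (Suc (n + N)))\<^sup>2))"
    proof (rule norm_suminf_le[OF _ cs])
      show "norm (v n) \<le> c * (1 / (real (Suc (n + N)))\<^sup>2)" for n
        using term_le[of "n + N"] w unfolding v_def by (simp add: norm_mult mult_ac)
    qed
    also have "\<dots> = c * (\<Sum>n. 1 / (real (Suc (n + N)))\<^sup>2)"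
      using summable_ignore_initial_segment[OF sums_summable[OF sq], of N] by (rule suminf_mult)
    also have "\<dots> \<le> c * (\<Sum>n. 1 / (real (Suc n))\<^sup>2)"
      using suminf_split_initial_segment[OF sums_summable[OF sq], of N] c
      by (intro mult_left_mono) (simp_all add: sum_nonneg)
    also have "\<dots> \<le> c * 2" using sq pi c by (intro mult_left_mono) (auto simp: sums_iff)
    also have "\<dots> \<le> 12 * x0 ^ 7" using x0pos by (auto simp: c_def intro!: power_increasing)
    finally show ?thesis unfolding eq .
  qed
qed

text \<open>The Newman estimate is applied with radius equal to the error bound \<open>E\<close>, so
  the two arcs contribute only the constant 2. On the chord \<open>F\<close> is at most
  \<open>x0 powr \<eta>\<close>, and the large radius enters through the logarithm.\<close>

lemma dirichlet_sum_log_bound: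
  assumes sums: "\<And>s. s \<in> halfplane 0 \<Longrightarrow> (\<lambda>n. dirichlet_term a n s) sums f s"
    and bound: "\<And>s. s \<in> halfplane 0 \<Longrightarrow> cmod (f s) \<le> 1"
    and s: "Re s > 0" and N: "N \<ge> 1" and \<eta>: "0 < \<eta>" "\<eta> \<le> 1" and x0: "x0 = real N + 1 / 2"
  shows "cmod (dirichlet_sum a N s) \<le> 2 + x0 powr \<eta> * (ln (1 + 24 * x0 ^ 7 / \<eta>) + 1)"
proof -
  have x01: "x0 > 1" using x0 N by simp
  define E where "E = 12 * x0 ^ 7"
  have "x0 ^ 7 \<ge> 1" using x01 by simp
  then have E: "E > 1" unfolding E_def by linarith
  have coeff: "cmod (a (Suc n)) \<le> (real (Suc n))\<^sup>2" for n
    using dirichlet_coefficient_bound[OF sums bound, of n] by simp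
  define P where "P = (\<lambda>w. dirichlet_sum a N (s + w) * of_real x0 powr w)"
  define F where "F = (\<lambda>w. f (s + w) * of_real x0 powr w)"
  have "cmod (P 0) \<le> 2 * E / E + x0 powr \<eta> * (ln (1 + 2 * E / \<eta>) + 1)"
  proof (rule Newman_contour_bound[where F = F])
    show "P holomorphic_on UNIV" unfolding P_def
      by (intro holomorphic_intros holomorphic_on_compose_gen[OF _ holomorphic_dirichlet_sum, unfolded o_def]) auto
    show "F holomorphic_on {w. 0 < Re w}" unfolding F_def
      by (intro holomorphic_intros holomorphic_on_compose_gen[OF _ dirichlet_series_holomorphic[OF sums], unfolded o_def])
        (use s in \<open>auto simp: halfplane_def\<close>)
    fix w assume w: "cmod w = E"
    show "\<bar>Re w\<bar> * cmod (P w) \<le> E" if "Re w \<le> \<eta>"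
    proof -
      have "\<bar>Re w\<bar> * cmod (P w) \<le> 2 * x0 ^ 4"
        unfolding P_def using s that \<eta> by (intro norm_dirichlet_sum_left_le coeff x0 N) auto
      also have "\<dots> \<le> 12 * x0 ^ 7" using x01 by (intro mult_mono power_increasing) auto
      finally show ?thesis by (simp add: E_def)
    qed
    show "Re w * cmod (F w - P w) \<le> E" if "\<eta> \<le> Re w"
      unfolding F_def P_def E_def using s that \<eta>
      by (intro norm_dirichlet_tail_right_le sums bound coeff x0 N) auto
  next
    fix w assume "Re w = \<eta>"
    then show "cmod (F w) \<le> x0 powr \<eta>"
      using bound[of "s + w"] s \<eta> x01
      by (auto simp: F_def norm_mult norm_powr_real_powr halfplane_def intro!: mult_left_le_one_le)
  qed (use \<eta> E in auto)
  then show ?thesis using E x01 by (simp add: P_def E_def)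
qed

text \<open>A weak form of Bohr's estimate; the bound is in fact logarithmic in \<open>N\<close>.\<close>

lemma dirichlet_sum_power_bound:
  assumes "\<delta> > 0"
  obtains C where "C > 0" "\<And>a f N s. (\<And>s. s \<in> halfplane 0 \<Longrightarrow> (\<lambda>n. dirichlet_term a n s) sums f s) \<Longrightarrow>
    (\<And>s. s \<in> halfplane 0 \<Longrightarrow> cmod (f s) \<le> 1) \<Longrightarrow> Re s > 0 \<Longrightarrow>
    cmod (dirichlet_sum a N s) \<le> C * real N powr \<delta>"
proof -
  \<comment> \<open>One factor \<open>x powr \<eta>\<close> comes from the chord and a second one
    absorbs the logarithm, hence half of \<delta>. The exponent \<theta> = \<eta> / 7 below undoes
    the seventh power inside the logarithm.\<close>
  define \<eta> where "\<eta> = min 1 (\<delta> / 2)"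
  have \<eta>: "0 < \<eta>" "\<eta> \<le> 1" "2 * \<eta> \<le> \<delta>" using assms by (auto simp: \<eta>_def)
  define \<theta> where "\<theta> = \<eta> / 7"
  have \<theta>: "\<theta> > 0" using \<eta> by (simp add: \<theta>_def)
  define c where "c = (25 / \<eta>) powr \<theta> / \<theta>"
  have c: "c \<ge> 0" using \<theta> by (simp add: c_def)
  have key: "2 + x powr \<eta> * (ln (1 + 24 * x ^ 7 / \<eta>) + 1) \<le> (3 + c) * x powr \<delta>" if x: "x \<ge> 1" for x :: real
  proof -
    have "x ^ 7 \<ge> 1" using x by simp
    have "1 + 24 * x ^ 7 / \<eta> \<le> 25 / \<eta> * x ^ 7"
    proof -
      have "1 \<le> x ^ 7 / \<eta>" using \<open>x ^ 7 \<ge> 1\<close> \<eta> by (simp add: field_simps)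
      then show ?thesis by (simp add: field_simps)
    qed
    moreover have "1 \<le> 1 + 24 * x ^ 7 / \<eta>" using x \<eta> by simp
    ultimately have "ln (1 + 24 * x ^ 7 / \<eta>) \<le> (25 / \<eta> * x ^ 7) powr \<theta> / \<theta>"
      using \<theta> by (intro order_trans[OF ln_powr_bound[of _ \<theta>] divide_right_mono] powr_mono2) auto
    also have "\<dots> = c * (x ^ 7) powr \<theta>" using powr_mult[of "25 / \<eta>" "x ^ 7" \<theta>] x \<eta> by (simp add: c_def)
    also have "(x ^ 7) powr \<theta> = x powr \<eta>" using x powr_powr[of x 7 \<theta>] by (simp add: \<theta>_def)
    finally have l: "ln (1 + 24 * x ^ 7 / \<eta>) \<le> c * x powr \<eta>" .
    have x\<eta>: "1 \<le> x powr \<eta>" using x \<eta> by (simp add: ge_one_powr_ge_zero)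
    have x\<eta>2: "x powr \<eta> \<le> x powr \<delta>" "1 \<le> x powr \<delta>"
      using x \<eta> assms by (auto simp: ge_one_powr_ge_zero intro!: powr_mono)
    have "2 + x powr \<eta> * (ln (1 + 24 * x ^ 7 / \<eta>) + 1) \<le> 2 + x powr \<eta> * (c * x powr \<eta> + 1)"
      using l by (intro add_left_mono mult_left_mono add_right_mono) auto
    also have "\<dots> = 2 + x powr \<eta> + c * x powr (2 * \<eta>)"
      by (simp add: algebra_simps flip: powr_add)
    also have "\<dots> \<le> 2 * x powr \<delta> + x powr \<delta> + c * x powr \<delta>"
      using x\<eta> x\<eta>2 c \<eta> x by (intro add_mono mult_left_mono powr_mono) auto
    finally show ?thesis by (simp add: algebra_simps)
  qed
  \<comment> \<open>The factor \<open>2 powr \<delta>\<close> pays for replacing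
    \<open>N + 1 / 2\<close> by \<open>2 * N\<close>.\<close>
  define C where "C = (3 + c) * 2 powr \<delta>"
  show ?thesis
  proof (rule that[of C])
    show "C > 0" using c by (simp add: C_def)
    fix a f N s
    assume sums: "\<And>s. s \<in> halfplane 0 \<Longrightarrow> (\<lambda>n. dirichlet_term a n s) sums f s"
      and bound: "\<And>s. s \<in> halfplane 0 \<Longrightarrow> cmod (f s) \<le> 1" and s: "Re s > (0::real)"
    show "cmod (dirichlet_sum a N s) \<le> C * real N powr \<delta>"
    proof (cases "N = 0")
      case True
      then show ?thesis by (simp add: dirichlet_sum_def)
    next
      case False
      define x where "x = real N + 1 / 2"
      have "cmod (dirichlet_sum a N s) \<le> 2 + x powr \<eta> * (ln (1 + 24 * x ^ 7 / \<eta>) + 1)"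
        using False \<eta> by (intro dirichlet_sum_log_bound[OF sums bound s]) (auto simp: x_def)
      also have "\<dots> \<le> (3 + c) * x powr \<delta>" using False by (intro key) (simp add: x_def)
      also have "\<dots> \<le> (3 + c) * (2 * real N) powr \<delta>"
        using c False assms by (intro mult_left_mono powr_mono2) (auto simp: x_def)
      also have "\<dots> = C * real N powr \<delta>" by (simp add: C_def powr_mult)
      finally show ?thesis .
    qed
  qed
qed

text \<open>With \<open>b = n powr - \<delta>\<close> the weights \<open>n powr - 2\<delta>\<close> are \<open>b\<^sup>2\<close>, and
  \<open>(b\<^sup>2 - b'\<^sup>2) / b \<le> 2 (b - b')\<close> makes the sum over the summation-by-parts remainder telescope.\<close>

lemma dirichlet_tail_bound:
  assumes "\<epsilon> > 0"
  obtains \<tau> :: "nat \<Rightarrow> real" where "\<tau> \<longlonglongrightarrow> 0"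
    "\<And>a f N s. (\<And>s. s \<in> halfplane 0 \<Longrightarrow> (\<lambda>n. dirichlet_term a n s) sums f s) \<Longrightarrow>
    (\<And>s. s \<in> halfplane 0 \<Longrightarrow> cmod (f s) \<le> 1) \<Longrightarrow> Re s \<ge> \<epsilon> \<Longrightarrow>
    cmod (f s - dirichlet_sum a N s) \<le> \<tau> N"
proof -
  \<comment> \<open>The shifted point \<open>s1 = s - 2 * \<delta>\<close> then keeps real part at
    least \<epsilon> / 2, so the partial sum bound holds there.\<close>
  define \<delta> where "\<delta> = \<epsilon> / 4"
  have \<delta>: "\<delta> > 0" using assms by (simp add: \<delta>_def)
  obtain C where C: "C > 0" "\<And>a f N s. (\<And>s. s \<in> halfplane 0 \<Longrightarrow> (\<lambda>n. dirichlet_term a n s) sums f s) \<Longrightarrow>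
    (\<And>s. s \<in> halfplane 0 \<Longrightarrow> cmod (f s) \<le> 1) \<Longrightarrow> Re s > 0 \<Longrightarrow>
    cmod (dirichlet_sum a N s) \<le> C * real N powr \<delta>"
    using dirichlet_sum_power_bound[OF \<delta>] by blast
  define b where "b = (\<lambda>n. real (Suc n) powr (- \<delta>))"
  have b: "b n > 0" for n by (simp add: b_def)
  have bdec: "b (Suc n) \<le> b n" for n unfolding b_def using \<delta> by (intro powr_mono2') auto
  have b2: "real (Suc n) powr (- (2 * \<delta>)) = b n * b n" for n
    unfolding b_def by (simp flip: powr_add)
  have blim: "b \<longlonglongrightarrow> 0" unfolding b_def using \<delta> by real_asymp
  show ?thesis
  proof (rule that[of "\<lambda>N. 3 * C * b N"])
    show "(\<lambda>N. 3 * C * b N) \<longlonglongrightarrow> 0" using blim by (intro tendsto_mult_right_zero)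
    fix a f N s
    assume sums: "\<And>s. s \<in> halfplane 0 \<Longrightarrow> (\<lambda>n. dirichlet_term a n s) sums f s"
      and bound: "\<And>s. s \<in> halfplane 0 \<Longrightarrow> cmod (f s) \<le> 1" and s: "Re s \<ge> (\<epsilon>::real)"
    define s1 where "s1 = s - of_real (2 * \<delta>)"
    have s1: "Re s1 > 0" using s assms by (simp add: s1_def \<delta>_def)
    define P where "P = (\<lambda>n. dirichlet_sum a n s1)"
    have P: "cmod (P n) \<le> C * real n powr \<delta>" for n
      unfolding P_def by (rule C(2)[OF sums bound s1])
    have Pb: "cmod (P (Suc n)) * b n \<le> C" for n
    proof -
      have "cmod (P (Suc n)) * b n \<le> (C * real (Suc n) powr \<delta>) * b n"
        using P[of "Suc n"] b[of n] by (intro mult_right_mono) auto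
      also have "\<dots> = C" by (simp add: b_def powr_minus)
      finally show ?thesis .
    qed
    have Pb': "cmod (P n) * b n \<le> C" for n
    proof -
      have "cmod (P n) * b n \<le> (C * real n powr \<delta>) * b n"
        using P[of n] b[of n] by (intro mult_right_mono) auto
      also have "\<dots> \<le> (C * real (Suc n) powr \<delta>) * b n"
        using C \<delta> b[of n] by (intro mult_right_mono mult_left_mono powr_mono2) auto
      also have "\<dots> = C" by (simp add: b_def powr_minus)
      finally show ?thesis .
    qed
    define \<beta> where "\<beta> = (\<lambda>n. b n * b n)"
    have term_eq: "dirichlet_term a n s = dirichlet_term a n s1 * of_real (\<beta> n)" for n
    proof -
      have "dirichlet_term a n (s1 + of_real (2 * \<delta>)) = dirichlet_term a n s1 * of_nat (Suc n) powr (- of_real (2 * \<delta>))"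
        by (rule dirichlet_term_add)
      also have "of_nat (Suc n) powr (- of_real (2 * \<delta>)) = (of_real (real (Suc n) powr (- (2 * \<delta>))) :: complex)"
        using powr_of_real[of "real (Suc n)" "- (2 * \<delta>)"] by (simp del: of_nat_Suc)
      finally show ?thesis unfolding b2 \<beta>_def s1_def by simp
    qed
    have dsum: "dirichlet_sum a M s = P M * of_real (\<beta> M) + (\<Sum>n<M. P (Suc n) * of_real (\<beta> n - \<beta> (Suc n)))" for M
      unfolding dirichlet_sum_def term_eq by (subst summation_by_parts) (simp only: P_def dirichlet_sum_def of_real_diff)
    have diff_le: "cmod (dirichlet_sum a M s - dirichlet_sum a N s) \<le> C * b M + C * b N + 2 * C * (b N - b M)" if "N \<le> M" for M
    proof -
      have "(\<Sum>n<M. P (Suc n) * of_real (\<beta> n - \<beta> (Suc n))) - (\<Sum>n<N. P (Suc n) * of_real (\<beta> n - \<beta> (Suc n)))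
          = (\<Sum>n=N..<M. P (Suc n) * of_real (\<beta> n - \<beta> (Suc n)))"
        using that by (simp add: sum_diff[symmetric] lessThan_atLeast0 ivl_diff)
      then have eq: "dirichlet_sum a M s - dirichlet_sum a N s = P M * of_real (\<beta> M) - P N * of_real (\<beta> N)
          + (\<Sum>n=N..<M. P (Suc n) * of_real (\<beta> n - \<beta> (Suc n)))"
        unfolding dsum by (simp add: algebra_simps)
      have 1: "cmod (P n * of_real (\<beta> n)) \<le> C * b n" for n
        using mult_right_mono[OF Pb'[of n] less_imp_le[OF b[of n]]] b[of n] by (simp add: \<beta>_def norm_mult mult_ac)
      have 2: "cmod (P (Suc n) * of_real (\<beta> n - \<beta> (Suc n))) \<le> 2 * C * (b n - b (Suc n))" for n
      proof -
        have "\<beta> n - \<beta> (Suc n) = (b n - b (Suc n)) * (b n + b (Suc n))"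
          by (simp add: \<beta>_def algebra_simps)
        then have "0 \<le> \<beta> n - \<beta> (Suc n)" "\<beta> n - \<beta> (Suc n) \<le> (b n - b (Suc n)) * (2 * b n)"
          using b[of n] b[of "Suc n"] bdec[of n] by (auto intro!: mult_left_mono)
        then have "cmod (P (Suc n) * of_real (\<beta> n - \<beta> (Suc n))) \<le> cmod (P (Suc n)) * ((b n - b (Suc n)) * (2 * b n))"
          unfolding norm_mult norm_of_real by (intro mult_left_mono) auto
        also have "\<dots> = (cmod (P (Suc n)) * b n) * (2 * (b n - b (Suc n)))" by simp
        also have "\<dots> \<le> C * (2 * (b n - b (Suc n)))"
          using Pb bdec[of n] by (intro mult_right_mono) auto
        also have "\<dots> = 2 * C * (b n - b (Suc n))" by (simp only: mult_ac)
        finally show ?thesis .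
      qed
      have "cmod (\<Sum>n=N..<M. P (Suc n) * of_real (\<beta> n - \<beta> (Suc n))) \<le> (\<Sum>n=N..<M. 2 * C * (b n - b (Suc n)))"
        by (intro sum_norm_le 2)
      also have "\<dots> = 2 * C * (\<Sum>n=N..<M. b n - b (Suc n))" by (rule sum_distrib_left[symmetric])
      also have "(\<Sum>n=N..<M. b n - b (Suc n)) = b N - b M"
        using sum_Suc_diff'[OF that, of "\<lambda>n. - b n"] by simp
      finally show ?thesis unfolding eq
        using 1[of M] 1[of N] norm_triangle_ineq4[of "P M * of_real (\<beta> M)" "P N * of_real (\<beta> N)"]
        by (intro norm_triangle_le) linarith
    qed
    have "(\<lambda>M. dirichlet_sum a M s) \<longlonglongrightarrow> f s"
      using sums[of s] s assms unfolding sums_def dirichlet_sum_def by (simp add: halfplane_def)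
    then have "(\<lambda>M. cmod (dirichlet_sum a M s - dirichlet_sum a N s)) \<longlonglongrightarrow> cmod (f s - dirichlet_sum a N s)"
      by (intro tendsto_intros)
    moreover have "(\<lambda>M. C * b M + C * b N + 2 * C * (b N - b M)) \<longlonglongrightarrow> C * 0 + C * b N + 2 * C * (b N - 0)"
      by (intro tendsto_intros blim)
    ultimately have "cmod (f s - dirichlet_sum a N s) \<le> C * 0 + C * b N + 2 * C * (b N - 0)"
      by (rule LIMSEQ_le) (use diff_le in blast)
    then show "cmod (f s - dirichlet_sum a N s) \<le> 3 * C * b N" by simp
  qed
qed

section \<open>Compactness and weak compactness\<close>

lemma hinf_dirichlet_series:
  obtains a where "\<And>s. s \<in> halfplane 0 \<Longrightarrow> (\<lambda>n. dirichlet_term a n s) sums hinf_fun f s"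
proof -
  obtain a where "\<forall>s\<in>halfplane 0. (\<lambda>n. a (Suc n) * of_nat (Suc n) powr (- s)) sums hinf_fun f s"
    using hinf_fun[of f] unfolding hinf_set_def by blast
  then show ?thesis by (intro that[of a]) (simp add: dirichlet_term_def)
qed

lemma hinf_of_dirichlet_series:
  assumes "\<And>s. s \<in> halfplane 0 \<Longrightarrow> (\<lambda>n. dirichlet_term a n s) sums f s"
    and "\<And>s. s \<in> halfplane 0 \<Longrightarrow> cmod (f s) \<le> B"
  obtains g where "\<And>s. s \<in> halfplane 0 \<Longrightarrow> hinf_fun g s = f s" "norm g \<le> B"
proof -
  define f' where "f' = (\<lambda>s. if s \<in> halfplane 0 then f s else 0)"
  have "bounded (f' ` halfplane 0)"
    using assms(2) by (auto simp: f'_def bounded_iff)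
  then have "f' \<in> hinf_set"
    using assms(1) by (auto simp: f'_def hinf_set_def dirichlet_term_def intro!: exI[of _ a])
  then have "hinf_fun (Abs_hinf f') = f'"
    by (rule Abs_hinf_inverse)
  then show ?thesis
    using assms(2) by (intro that[of "Abs_hinf f'"] norm_hinf_le) (auto simp: f'_def)
qed

section \<open>Product compactness and a Montel theorem for bounded Dirichlet series\<close>

text \<open>Tychonoff's theorem for the function type. It serves both for coefficient sequences and,
  with index type \<open>hinf\<close>, for functionals.\<close>

lemma compact_PiE_UNIV:
  fixes S :: "'i \<Rightarrow> 'a::topological_space set"
  assumes "\<And>i. compact (S i)"
  shows "compact {x. \<forall>i. x i \<in> S i}"
proof -
  have "compactin (product_topology (\<lambda>_. euclidean) UNIV) (PiE UNIV S)"
    using assms by (simp add: compactin_PiE)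
  then show ?thesis
    by (simp add: euclidean_product_topology PiE_UNIV_domain Pi_def)
qed

lemma tendsto_apply_coordinate:
  fixes x :: "'i \<Rightarrow> 'a::topological_space"
  assumes "(f \<longlongrightarrow> x) F"
  shows "((\<lambda>t. f t i) \<longlongrightarrow> x i) F"
proof -
  have "continuous_on UNIV (\<lambda>x::'i \<Rightarrow> 'a. x i)" by simp
  from continuous_on_tendsto_compose[OF this assms] show ?thesis by simp
qed

text \<open>The coefficient bound confines the coefficients to a product of disks, which yields a
  coefficientwise convergent subsequence. The uniform tail bound passes to partial sums of the limit
  coefficients, so their series converges. The same bound reduces the distance of the functions to
  finitely many coefficients, which is why convergence is uniform on a whole half-plane.\<close>

lemma hinf_Montel:
  fixes F :: "nat \<Rightarrow> hinf"
  assumes F: "\<And>k. norm (F k) \<le> 1"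
  obtains r G where "strict_mono r" "norm (G :: hinf) \<le> 1"
    "\<And>\<epsilon>. \<epsilon> > 0 \<Longrightarrow> uniform_limit (halfplane \<epsilon>) (\<lambda>k. hinf_fun (F (r k))) (hinf_fun G) sequentially"
proof -
  have "\<forall>k. \<exists>a. \<forall>s\<in>halfplane 0. (\<lambda>n. dirichlet_term a n s) sums hinf_fun (F k) s"
    using hinf_dirichlet_series by metis
  then obtain A where A: "\<And>k s. s \<in> halfplane 0 \<Longrightarrow> (\<lambda>n. dirichlet_term (A k) n s) sums hinf_fun (F k) s"
    by metis
  have F1: "cmod (hinf_fun (F k) s) \<le> 1" if "s \<in> halfplane 0" for k s
    using cmod_hinf_fun_le_norm[OF that, of "F k"] F[of k] by linarith
  define x where "x = (\<lambda>k n. A k (Suc n))"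
  have "\<forall>k. x k \<in> {y. \<forall>n. y n \<in> cball 0 ((real (Suc n))\<^sup>2)}"
    using dirichlet_coefficient_bound[OF A F1] by (simp add: x_def del: of_nat_Suc)
  moreover have "seq_compact {y :: nat \<Rightarrow> complex. \<forall>n. y n \<in> cball 0 ((real (Suc n))\<^sup>2)}"
    by (intro compact_imp_seq_compact compact_PiE_UNIV compact_cball)
  ultimately obtain l r where r: "strict_mono r" and l: "(x \<circ> r) \<longlonglongrightarrow> l"
    unfolding seq_compact_def by blast
  \<comment> \<open>Returns to indices starting at 1; the value at 0 is a dummy.\<close>
  define a where "a = (\<lambda>n. l (n - 1))"
  have lim: "(\<lambda>k. A (r k) (Suc n)) \<longlonglongrightarrow> a (Suc n)" for n
    using tendsto_apply_coordinate[OF l, of n] by (simp add: a_def x_def o_def)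
  define e where "e = (\<lambda>N k. \<Sum>n<N. cmod (A (r k) (Suc n) - a (Suc n)))"
  have elim: "e N \<longlonglongrightarrow> 0" for N
  proof -
    have "e N \<longlonglongrightarrow> (\<Sum>n<N. cmod (a (Suc n) - a (Suc n)))"
      unfolding e_def by (intro tendsto_intros lim)
    then show ?thesis by simp
  qed
  have e: "cmod (dirichlet_sum (A (r k)) N s - dirichlet_sum a N s) \<le> e N k" if s: "Re s \<ge> 0" for N k s
  proof -
    have "cmod (dirichlet_term (A (r k)) n s - dirichlet_term a n s) \<le> cmod (A (r k) (Suc n) - a (Suc n))" for n
    proof -
      have "real (Suc n) powr (- Re s) \<le> real (Suc n) powr 0"
        using s by (intro powr_mono) auto
      then show ?thesis
        unfolding dirichlet_term_def left_diff_distrib[symmetric] norm_mult norm_of_nat_Suc_powr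
        by (intro mult_left_le) auto
    qed
    then show ?thesis
      unfolding e_def dirichlet_sum_def sum_subtractf[symmetric] by (intro sum_norm_le)
  qed
  have tail: "\<exists>\<tau>. \<tau> \<longlonglongrightarrow> 0 \<and> (\<forall>k N s. Re s \<ge> \<epsilon> \<longrightarrow> cmod (hinf_fun (F (r k)) s - dirichlet_sum (A (r k)) N s) \<le> \<tau> N)
      \<and> (\<forall>M N s. Re s \<ge> \<epsilon> \<longrightarrow> cmod (dirichlet_sum a M s - dirichlet_sum a N s) \<le> \<tau> M + \<tau> N)"
    if \<epsilon>: "\<epsilon> > 0" for \<epsilon>
  proof -
    obtain \<tau> where \<tau>: "\<tau> \<longlonglongrightarrow> 0"
        "\<And>k N s. Re s \<ge> \<epsilon> \<Longrightarrow> cmod (hinf_fun (F (r k)) s - dirichlet_sum (A (r k)) N s) \<le> \<tau> N"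
      by (rule dirichlet_tail_bound[OF \<epsilon>]) (use A F1 in blast)
    have "cmod (dirichlet_sum a M s - dirichlet_sum a N s) \<le> \<tau> M + \<tau> N" if s: "Re s \<ge> \<epsilon>" for M N s
    proof -
      have "cmod (dirichlet_sum a M s - dirichlet_sum a N s) \<le> \<tau> M + \<tau> N + (e M k + e N k)" for k
        using \<tau>(2)[OF s, of k M] \<tau>(2)[OF s, of k N] e[of s k M] e[of s k N] s \<epsilon> by norm
      moreover have "(\<lambda>k. \<tau> M + \<tau> N + (e M k + e N k)) \<longlonglongrightarrow> \<tau> M + \<tau> N + (0 + 0)"
        by (intro tendsto_intros elim)
      ultimately show ?thesis by (intro Lim_bounded2[of _ "\<tau> M + \<tau> N" 0]) auto
    qed
    with \<tau> show ?thesis by blast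
  qed
  have "convergent (\<lambda>N. dirichlet_sum a N s)" if s: "s \<in> halfplane 0" for s
  proof -
    have s0: "Re s > 0" using s by (simp add: halfplane_def)
    obtain \<tau> where \<tau>: "\<tau> \<longlonglongrightarrow> 0" "\<And>M N. cmod (dirichlet_sum a M s - dirichlet_sum a N s) \<le> \<tau> M + \<tau> N"
      using tail[OF s0] by blast
    have "Cauchy (\<lambda>N. dirichlet_sum a N s)"
    proof (rule metric_CauchyI)
      fix d :: real assume d: "d > 0"
      then obtain K where K: "\<And>n. n \<ge> K \<Longrightarrow> \<bar>\<tau> n\<bar> < d / 2"
        using LIMSEQ_D[OF \<tau>(1), of "d / 2"] by auto
      show "\<exists>K. \<forall>m\<ge>K. \<forall>n\<ge>K. dist (dirichlet_sum a m s) (dirichlet_sum a n s) < d"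
      proof (intro exI[of _ K] allI impI)
        fix m n assume "K \<le> m" "K \<le> n"
        then show "dist (dirichlet_sum a m s) (dirichlet_sum a n s) < d"
          using \<tau>(2)[of m n] K[of m] K[of n] unfolding dist_norm by linarith
      qed
    qed
    then show ?thesis by (simp add: Cauchy_convergent_iff)
  qed
  then obtain f where f: "\<And>s. s \<in> halfplane 0 \<Longrightarrow> (\<lambda>N. dirichlet_sum a N s) \<longlonglongrightarrow> f s"
    unfolding convergent_def by metis
  have unif: "\<forall>\<^sub>F k in sequentially. \<forall>s\<in>halfplane \<epsilon>. dist (hinf_fun (F (r k)) s) (f s) < d"
    if \<epsilon>: "\<epsilon> > 0" and d: "d > 0" for \<epsilon> d
  proof -
    obtain \<tau> where \<tau>: "\<tau> \<longlonglongrightarrow> 0"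
        "\<And>k N s. Re s \<ge> \<epsilon> \<Longrightarrow> cmod (hinf_fun (F (r k)) s - dirichlet_sum (A (r k)) N s) \<le> \<tau> N"
        "\<And>M N s. Re s \<ge> \<epsilon> \<Longrightarrow> cmod (dirichlet_sum a M s - dirichlet_sum a N s) \<le> \<tau> M + \<tau> N"
      using tail[OF \<epsilon>] by blast
    have f_tail: "cmod (f s - dirichlet_sum a N s) \<le> \<tau> N" if s: "Re s \<ge> \<epsilon>" for N s
    proof -
      have "(\<lambda>M. cmod (dirichlet_sum a M s - dirichlet_sum a N s)) \<longlonglongrightarrow> cmod (f s - dirichlet_sum a N s)"
        using s \<epsilon> by (intro tendsto_intros f) (simp add: halfplane_def)
      moreover have "(\<lambda>M. \<tau> M + \<tau> N) \<longlonglongrightarrow> 0 + \<tau> N" by (intro tendsto_intros \<tau>(1))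
      ultimately have "cmod (f s - dirichlet_sum a N s) \<le> 0 + \<tau> N"
        by (rule LIMSEQ_le) (use \<tau>(3)[OF s] in blast)
      then show ?thesis by simp
    qed
    obtain N where N: "\<And>n. n \<ge> N \<Longrightarrow> \<bar>\<tau> n\<bar> < d / 4"
      using LIMSEQ_D[OF \<tau>(1), of "d / 4"] d by auto
    have "\<forall>\<^sub>F k in sequentially. e N k < d / 4"
      using order_tendstoD(2)[OF elim[of N], of "d / 4"] d by simp
    then show ?thesis
    proof eventually_elim
      case (elim k)
      show ?case
      proof
        fix s assume s: "s \<in> halfplane \<epsilon>"
        then have s': "Re s \<ge> \<epsilon>" "Re s \<ge> 0" using \<epsilon> by (auto simp: halfplane_def)
        have "cmod (hinf_fun (F (r k)) s - f s) < d"
          using \<tau>(2)[OF s'(1), of k N] f_tail[OF s'(1), of N] e[OF s'(2), of k N] N[OF order_refl] elim d by norm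
        then show "dist (hinf_fun (F (r k)) s) (f s) < d"
          by (simp add: dist_norm)
      qed
    qed
  qed
  have f1: "cmod (f s) \<le> 1" if s: "s \<in> halfplane 0" for s
  proof (rule tendsto_upperbound)
    have "s \<in> halfplane (Re s / 2)" "Re s / 2 > 0" using s by (auto simp: halfplane_def)
    then have "(\<lambda>k. hinf_fun (F (r k)) s) \<longlonglongrightarrow> f s"
      using unif by (intro tendstoI) (fast elim: eventually_mono)
    then show "(\<lambda>k. cmod (hinf_fun (F (r k)) s)) \<longlonglongrightarrow> cmod (f s)" by (rule tendsto_norm)
  qed (use F1[OF s] in auto)
  have "(\<lambda>n. dirichlet_term a n s) sums f s" if "s \<in> halfplane 0" for s
    using f[OF that] by (simp add: sums_def dirichlet_sum_def)
  from hinf_of_dirichlet_series[OF this f1]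
  obtain G where G: "\<And>s. s \<in> halfplane 0 \<Longrightarrow> hinf_fun G s = f s" "norm G \<le> 1"
    by blast
  show ?thesis
  proof (rule that[OF r G(2)])
    fix \<epsilon> :: real assume \<epsilon>: "\<epsilon> > 0"
    then have "f s = hinf_fun G s" if "s \<in> halfplane \<epsilon>" for s
      using that G(1)[of s] by (simp add: halfplane_def)
    with unif[OF \<epsilon>] show "uniform_limit (halfplane \<epsilon>) (\<lambda>k. hinf_fun (F (r k))) (hinf_fun G) sequentially"
      by (simp add: uniform_limit_iff)
  qed
qed

section \<open>The weak topology and compactness of composition operators\<close>

lemma bounded_clinear_evaluation:
  assumes "s \<in> halfplane 0"
  shows "bounded_clinear (\<lambda>f::hinf. hinf_fun f s)"
proof -
  have "bounded_linear (\<lambda>f::hinf. hinf_fun f s)"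
    by (rule bounded_linear_intro[where K = 1])
      (simp_all add: cmod_hinf_fun_le_norm[OF assms] scaleR_conv_of_real)
  then show ?thesis by (simp add: bounded_clinear_def scaleC_complex_def)
qed

lemma continuous_map_weak_topology:
  "bounded_clinear \<phi> \<Longrightarrow> continuous_map weak_topology euclidean (\<phi> :: 'a::complex_normed_vector \<Rightarrow> complex)"
  unfolding continuous_map_def topspace_weak_topology
proof (intro conjI allI impI)
  fix U :: "complex set" assume "bounded_clinear \<phi>" "openin euclidean U"
  then have "openin weak_topology (\<phi> -` U)"
    unfolding weak_topology_def by (intro topology_generated_by_Basis) auto
  then show "openin weak_topology {x \<in> UNIV. \<phi> x \<in> U}" by (simp add: vimage_def)
qed simp

lemma continuous_map_euclidean_weak_topology:
  "continuous_map euclidean (weak_topology :: 'a::complex_normed_vector topology) (\<lambda>x. x)"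
  unfolding weak_topology_def
proof (rule continuous_on_generated_topo)
  fix U :: "'a set" assume "U \<in> {\<phi> -` U |\<phi> U. bounded_clinear (\<phi> :: 'a \<Rightarrow> complex) \<and> open U}"
  then obtain \<phi> :: "'a \<Rightarrow> complex" and V where U: "U = \<phi> -` V" "bounded_clinear \<phi>" "open V" by blast
  then have "continuous_on UNIV \<phi>" by (auto simp: bounded_clinear_def intro: linear_continuous_on)
  then show "openin euclidean ((\<lambda>x. x) -` U \<inter> topspace euclidean)"
    using U by (simp add: open_vimage)
next
  show "(\<lambda>x. x) ` topspace euclidean \<subseteq> \<Union> {\<phi> -` U |\<phi> U. bounded_clinear (\<phi> :: 'a \<Rightarrow> complex) \<and> open U}"
    using topspace_weak_topology[where ?'a = 'a] unfolding weak_topology_def topology_generated_by_topspace by simp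
qed

text \<open>Point evaluations are bounded functionals and separate the elements of
  \<open>hinf\<close>.\<close>

lemma Hausdorff_weak_topology_hinf: "Hausdorff_space (weak_topology :: hinf topology)"
  unfolding Hausdorff_space_def
proof (intro allI impI, elim conjE)
  fix f g :: hinf assume "f \<noteq> g"
  then obtain s where s: "s \<in> halfplane 0" "hinf_fun f s \<noteq> hinf_fun g s" using hinf_eqI by blast
  then obtain U V where UV: "open U" "open V" "hinf_fun f s \<in> U" "hinf_fun g s \<in> V" "U \<inter> V = {}"
    using hausdorff by metis
  let ?e = "\<lambda>f::hinf. hinf_fun f s"
  have open_ev: "openin weak_topology (?e -` W)" if "open W" for W
    using continuous_map_weak_topology[OF bounded_clinear_evaluation[OF s(1)]] that
    by (simp add: continuous_map_def topspace_weak_topology vimage_def)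
  have "disjnt (?e -` U) (?e -` V)" using UV by (auto simp: disjnt_def)
  then show "\<exists>U V. openin weak_topology U \<and> openin weak_topology V \<and> f \<in> U \<and> g \<in> V \<and> disjnt U V"
    using UV open_ev by (intro exI[of _ "?e -` U"] exI[of _ "?e -` V"]) auto
qed

text \<open>The norm closure of the image is compact also for the coarser weak topology, hence
  weakly closed by the Hausdorff property. It therefore contains the weak closure, a closed subset
  of a compact set.\<close>

lemma compact_imp_weakly_compact_operator:
  fixes T :: "'a::complex_normed_vector \<Rightarrow> hinf"
  assumes "compact_operator T"
  shows "weakly_compact_operator T"
proof -
  let ?K = "closure (T ` cball 0 1)"
  have "compactin euclidean ?K" using assms by (simp add: compact_operator_def)
  then have K: "compactin weak_topology ?K"
    using image_compactin[OF _ continuous_map_euclidean_weak_topology] by simp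
  then have "closedin weak_topology ?K"
    using Hausdorff_weak_topology_hinf compactin_imp_closedin by blast
  then have "weak_topology closure_of (T ` cball 0 1) \<subseteq> ?K"
    by (intro closure_of_minimal closure_subset)
  then show ?thesis
    using assms K closed_compactin[OF K] unfolding weakly_compact_operator_def compact_operator_def by simp
qed

text \<open>The norm of \<open>C f\<close> only sees the values of \<open>f\<close> on the image of
  \<Phi>, which lies where the Montel theorem gives uniform convergence. The limit stays in the unit
  ball, so already the image of the ball is compact.\<close>

lemma composition_operator_compact:
  assumes \<Phi>: "\<Phi> ` halfplane 0 \<subseteq> halfplane \<epsilon>" "\<epsilon> > 0"
    and C: "is_composition_operator \<Phi> C" "bounded_clinear C"
  shows "compact_operator C"
proof -
  have "seq_compact (C ` cball 0 1)"
  proof (rule seq_compactI)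
    fix h :: "nat \<Rightarrow> hinf" assume "\<forall>n. h n \<in> C ` cball 0 1"
    then have "\<exists>f. norm f \<le> 1 \<and> h k = C f" for k by (drule_tac spec[of _ k]) auto
    then obtain F where F: "\<And>k. norm (F k) \<le> 1" "\<And>k. h k = C (F k)" by metis
    obtain r G where G: "strict_mono r" "norm G \<le> 1"
        "uniform_limit (halfplane \<epsilon>) (\<lambda>k. hinf_fun (F (r k))) (hinf_fun G) sequentially"
      by (rule hinf_Montel[of F, OF F(1)]) (use \<Phi>(2) in blast)
    have "(h \<circ> r) \<longlonglongrightarrow> C G"
    proof (rule tendstoI)
      fix d :: real assume d: "d > 0"
      have "\<forall>\<^sub>F k in sequentially. \<forall>s\<in>halfplane \<epsilon>. dist (hinf_fun (F (r k)) s) (hinf_fun G s) < d / 2"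
        using G(3) half_gt_zero[OF d] unfolding uniform_limit_iff by blast
      then show "\<forall>\<^sub>F k in sequentially. dist ((h \<circ> r) k) (C G) < d"
      proof eventually_elim
        case (elim k)
        have "norm (C (F (r k)) - C G) \<le> d / 2"
        proof (rule norm_hinf_le)
          fix s assume s: "s \<in> halfplane 0"
          then have "\<Phi> s \<in> halfplane \<epsilon>" using \<Phi> by blast
          then show "cmod (hinf_fun (C (F (r k)) - C G) s) \<le> d / 2"
            using elim s C(1) by (simp add: is_composition_operator_def dist_norm less_imp_le)
        qed
        then show ?case using d by (simp add: F dist_norm)
      qed
    qed
    then show "\<exists>l\<in>C ` cball 0 1. \<exists>r. strict_mono r \<and> (h \<circ> r) \<longlonglongrightarrow> l"
      using G by (intro bexI[of _ "C G"] exI[of _ r]) auto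
  qed
  then have "compact (C ` cball 0 1)" by (simp add: compact_eq_seq_compact_metric)
  then show ?thesis using C by (simp add: compact_operator_def compact_imp_closed closure_closed)
qed

lemma linear_continuous_imp_bounded:
  fixes J :: "'a::real_normed_vector \<Rightarrow> 'b::real_normed_vector"
  assumes "continuous_on UNIV J" "\<And>r x. J (r *\<^sub>R x) = r *\<^sub>R J x"
  obtains B where "B > 0" "\<And>x. norm (J x) \<le> B * norm x"
proof -
  have J0: "J 0 = 0" using assms(2)[of 0 0] by simp
  obtain d where d: "d > 0" "\<And>x. norm x < d \<Longrightarrow> norm (J x) < 1"
  proof -
    have "isCont J 0" using assms(1) by (simp add: continuous_on_eq_continuous_at)
    then have "\<exists>d>0. \<forall>x. dist x 0 < d \<longrightarrow> dist (J x) (J 0) < 1"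
      unfolding continuous_at_eps_delta using zero_less_one by blast
    then show ?thesis using that J0 by auto
  qed
  show ?thesis
  proof (rule that[of "2 / d"])
    fix x
    show "norm (J x) \<le> 2 / d * norm x"
    proof (cases "x = 0")
      case False
      define c where "c = d / (2 * norm x)"
      have c: "c > 0" using d False by (simp add: c_def)
      have "norm (c *\<^sub>R x) < d" using d False by (simp add: c_def)
      from d(2)[OF this] have "c * norm (J x) < 1" using c by (simp add: assms(2))
      then show ?thesis using d False by (simp add: c_def field_simps)
    qed (simp add: J0)
  qed (use d in simp)
qed

text \<open>Distinct unit vectors are at distance at least 1, whereas compactness makes the images
  of a subsequence of them converge. Continuity of the inverse isomorphisms carries this back to the
  unit vectors.\<close>

lemma compact_operator_not_fixes_linfty:
  fixes T :: "'a::complex_normed_vector \<Rightarrow> 'b::complex_normed_vector"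
  assumes T: "compact_operator T"
  shows "\<not> fixes_copy T TYPE(linfty)"
proof
  assume "fixes_copy T TYPE(linfty)"
  then obtain Z J S R where Z: "csubspace Z"
    and Jadd: "\<And>x y. J (x + y :: linfty) = J x + J y" and JC: "\<And>c x. J (c *\<^sub>C x) = c *\<^sub>C J x"
    and J: "homeomorphism UNIV Z J S" and R: "homeomorphism Z (T ` Z) T R"
    unfolding fixes_copy_def normed_isomorphism_def by auto
  have JR: "J (r *\<^sub>R x) = r *\<^sub>R J x" for r x using JC[of "complex_of_real r" x] by (simp add: scaleC_of_real)
  obtain B where B: "B > 0" "\<And>x. norm (J x) \<le> B * norm x"
    using linear_continuous_imp_bounded[of J] J JR unfolding homeomorphism_def by metis
  have lT: "bounded_linear T" using T by (simp add: compact_operator_def bounded_clinear_def)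
  interpret T: bounded_linear T by (rule lT)
  obtain u :: "nat \<Rightarrow> linfty" where u: "\<And>n. apply_bcontfun (u n) = (\<lambda>k. if k = n then 1 else 0)"
  proof -
    have "\<exists>v :: linfty. apply_bcontfun v = (\<lambda>k. if k = n then 1 else 0)" for n
    proof -
      have "bounded (range (\<lambda>k. if k = n then 1 else 0 :: complex))"
        by (rule finite_imp_bounded, rule finite_subset[of _ "{0,1}"]) auto
      then show ?thesis using bounded_sequence_linfty by metis
    qed
    then show ?thesis using that by metis
  qed
  have u1: "norm (u n) \<le> 1" for n by (rule norm_bound) (simp add: u)
  have sc: "seq_compact (closure (T ` cball 0 1))"
    using T by (simp add: compact_operator_def compact_eq_seq_compact_metric)
  have inK: "T (J (u n) /\<^sub>R B) \<in> closure (T ` cball 0 1)" for n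
  proof -
    have "norm (J (u n)) \<le> B * 1" using B(2)[of "u n"] mult_left_mono[OF u1[of n], of B] B(1) by linarith
    then have "J (u n) /\<^sub>R B \<in> cball 0 1" using B(1) by (simp add: field_simps)
    then show ?thesis by (intro closure_subset[THEN subsetD] imageI)
  qed
  from sc[unfolded seq_compact_def, rule_format, of "\<lambda>n. T (J (u n) /\<^sub>R B)", OF inK]
  obtain l r where r: "strict_mono r" and l: "((\<lambda>n. T (J (u n) /\<^sub>R B)) \<circ> r) \<longlonglongrightarrow> l"
    by blast
  \<comment> \<open>The limit \<open>l\<close> may lie outside the image of \<open>Z\<close>, where
    \<open>R\<close> is not known to be continuous. Consecutive differences have images tending to
    0, which does belong to it.\<close>
  define v where "v = (\<lambda>i. u (r i) - u (r (Suc i)))"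
  have Jdiff: "J (x - y) = J x - J y" for x y using Jadd[of "x - y" y] by simp
  have l': "(\<lambda>i. T (J (u (r i)) /\<^sub>R B)) \<longlonglongrightarrow> l" using l by (simp add: o_def)
  have "(\<lambda>i. B *\<^sub>R (T (J (u (r i)) /\<^sub>R B) - T (J (u (r (Suc i))) /\<^sub>R B))) \<longlonglongrightarrow> B *\<^sub>R (l - l)"
    by (intro tendsto_intros l' LIMSEQ_Suc[OF l'])
  then have lim: "(\<lambda>i. T (J (v i))) \<longlonglongrightarrow> 0"
    using B(1) by (simp add: v_def Jdiff T.diff T.scaleR scaleR_diff_right)
  have JZ: "J x \<in> Z" for x using J unfolding homeomorphism_def by auto
  have J0: "J 0 = 0" using JR[of 0 0] by simp
  have contR: "continuous_on (T ` Z) R" and RT: "\<And>z. z \<in> Z \<Longrightarrow> R (T z) = z" using R unfolding homeomorphism_def by auto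
  have contS: "continuous_on Z S" and SJ: "\<And>x. S (J x) = x" using J unfolding homeomorphism_def by auto
  have "(\<lambda>i. R (T (J (v i)))) \<longlonglongrightarrow> R (T (J 0))"
    by (rule continuous_on_tendsto_compose[OF contR]) (use lim JZ image_eqI[of 0 T 0 Z] JZ[of 0] in \<open>auto simp: J0 T.zero\<close>)
  then have "(\<lambda>i. J (v i)) \<longlonglongrightarrow> J 0" by (simp add: RT JZ)
  then have "(\<lambda>i. S (J (v i))) \<longlonglongrightarrow> S (J 0)"
    by (rule continuous_on_tendsto_compose[OF contS]) (use JZ in auto)
  then have "v \<longlonglongrightarrow> 0" by (simp add: SJ)
  then have "(\<lambda>i. norm (v i)) \<longlonglongrightarrow> 0" by (rule tendsto_norm_zero)
  moreover have "norm (v i) \<ge> 1" for i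
  proof -
    have "r i \<noteq> r (Suc i)" using strict_monoD[OF r, of i "Suc i"] by simp
    then have "cmod (apply_bcontfun (v i) (r i)) = 1" by (simp add: v_def u)
    then show ?thesis using norm_bounded[of "v i" "r i"] by simp
  qed
  ultimately have "(1::real) \<le> 0" by (intro tendsto_lowerbound[of _ 0 sequentially 1]) auto
  then show False by simp
qed

text \<open>A cluster point of the point evaluations in the product of the disks of radius \<open>norm f\<close>
  plays the role of a limit along an ultrafilter.\<close>

lemma cluster_evaluation:
  assumes s: "\<And>k. s k \<in> halfplane 0"
  obtains \<phi> :: "hinf \<Rightarrow> complex" where "bounded_clinear \<phi>"
    "\<And>f l. (\<lambda>k. hinf_fun f (s k)) \<longlonglongrightarrow> l \<Longrightarrow> \<phi> f = l"
    "\<And>f S. closed S \<Longrightarrow> \<forall>k. hinf_fun f (s k) \<in> S \<Longrightarrow> \<phi> f \<in> S"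
proof -
  define ev where "ev = (\<lambda>k (f::hinf). hinf_fun f (s k))"
  define K where "K = {\<psi> :: hinf \<Rightarrow> complex. \<forall>f. \<psi> f \<in> cball 0 (norm f)}"
  have "compact K" unfolding K_def by (intro compact_PiE_UNIV compact_cball)
  moreover have "ev k \<in> K" for k using cmod_hinf_fun_le_norm[OF s] by (simp add: K_def ev_def)
  then have "eventually (\<lambda>\<psi>. \<psi> \<in> K) (filtermap ev sequentially)" by (simp add: eventually_filtermap)
  moreover have "filtermap ev sequentially \<noteq> bot" by (simp add: filtermap_bot_iff)
  ultimately obtain \<phi> where \<phi>: "\<phi> \<in> K" "inf (nhds \<phi>) (filtermap ev sequentially) \<noteq> bot"
    unfolding compact_filter by blast
  \<comment> \<open>Compactness of a product over the uncountable type \<open>hinf\<close> provides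
    no convergent subsequence in general. This proper filter, finer than the sequence of evaluations
    and convergent to \<phi>, replaces one.\<close>
  define F where "F = inf (nhds \<phi>) (filtermap ev sequentially)"
  have "F \<le> nhds \<phi>" unfolding F_def by simp
  then have "((\<lambda>\<psi>. \<psi>) \<longlongrightarrow> \<phi>) F" unfolding filterlim_def by simp
  then have lim: "((\<lambda>\<psi>. \<psi> f) \<longlongrightarrow> \<phi> f) F" for f by (rule tendsto_apply_coordinate)
  have Fbot: "F \<noteq> bot" using \<phi> by (simp add: F_def)
  have Fle: "F \<le> filtermap ev sequentially" by (simp add: F_def)
  have ev: "eventually P F" if "\<And>k. P (ev k)" for P
    using that by (intro filter_leD[OF Fle]) (simp add: eventually_filtermap)
  have add: "\<phi> (f + g) = \<phi> f + \<phi> g" for f g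
  proof (rule tendsto_unique[OF Fbot lim])
    have "((\<lambda>\<psi>. \<psi> f + \<psi> g) \<longlongrightarrow> \<phi> f + \<phi> g) F" by (intro tendsto_intros lim)
    then show "((\<lambda>\<psi>. \<psi> (f + g)) \<longlongrightarrow> \<phi> f + \<phi> g) F"
      by (rule Lim_transform_eventually) (rule ev, simp add: ev_def)
  qed
  have scale: "\<phi> (c *\<^sub>C f) = c * \<phi> f" for c f
  proof (rule tendsto_unique[OF Fbot lim])
    have "((\<lambda>\<psi>. c * \<psi> f) \<longlongrightarrow> c * \<phi> f) F" by (intro tendsto_intros lim)
    then show "((\<lambda>\<psi>. \<psi> (c *\<^sub>C f)) \<longlongrightarrow> c * \<phi> f) F"
      by (rule Lim_transform_eventually) (rule ev, simp add: ev_def)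
  qed
  show ?thesis
  proof (rule that)
    have "\<phi> (r *\<^sub>R f) = r *\<^sub>R \<phi> f" for r f
      using scale[of "complex_of_real r" f] by (simp add: scaleC_of_real scaleR_conv_of_real)
    then have "bounded_linear \<phi>" using \<phi>(1)
      by (intro bounded_linear_intro[where K = 1] add) (auto simp: K_def)
    then show "bounded_clinear \<phi>" by (simp add: bounded_clinear_def scale scaleC_complex_def)
  next
    fix f l assume "(\<lambda>k. hinf_fun f (s k)) \<longlonglongrightarrow> l"
    then have "((\<lambda>\<psi>. \<psi> f) \<longlongrightarrow> l) (filtermap ev sequentially)"
      by (simp add: filterlim_filtermap ev_def)
    then have "((\<lambda>\<psi>. \<psi> f) \<longlongrightarrow> l) F" using Fle by (rule tendsto_mono[rotated])
    then show "\<phi> f = l" using tendsto_unique[OF Fbot lim] by blast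
  next
    fix f and S :: "complex set" assume "closed S" "\<forall>k. hinf_fun f (s k) \<in> S"
    then show "\<phi> f \<in> S"
      by (intro Lim_in_closed_set[OF _ _ Fbot lim] ev) (auto simp: ev_def)
  qed
qed

section \<open>Embedding bounded sequences\<close>

text \<open>Substituting \<open>2 powr (- s)\<close> for the variable turns a power series into a
  Dirichlet series supported on the powers of 2, and the right half-plane goes into the unit disk.
  Functions on the disk thus become elements of \<open>hinf\<close> with no larger bound.\<close>

lemma hinf_of_power_series:
  assumes f: "f holomorphic_on ball 0 1" and B: "\<And>z. cmod z < 1 \<Longrightarrow> cmod (f z) \<le> B"
  obtains g where "\<And>s. s \<in> halfplane 0 \<Longrightarrow> hinf_fun g s = f (2 powr (- s))" "norm g \<le> B"
proof -
  define b where "b = (\<lambda>k. (deriv ^^ k) f 0 / fact k)"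
  define a where "a = (\<lambda>n. if n \<in> range (\<lambda>k. 2 ^ k) then b (inv (\<lambda>k. 2 ^ k :: nat) n) else 0)"
  have inj: "inj (\<lambda>k. 2 ^ k :: nat)" by (auto simp: inj_def)
  have a2: "a (2 ^ k) = b k" for k using inv_f_f[OF inj, of k] by (simp add: a_def)
  have small: "cmod (2 powr (- s)) < 1" if "s \<in> halfplane 0" for s
    using that by (simp add: halfplane_def norm_powr_real_powr powr_less_one)
  have "(\<lambda>n. dirichlet_term a n s) sums f (2 powr (- s))" if s: "s \<in> halfplane 0" for s
  proof -
    \<comment> \<open>The coefficient of index \<open>2 ^ k\<close> sits in the term numbered one
      less.\<close>
    define g where "g = (\<lambda>k. 2 ^ k - 1 :: nat)"
    have Suc_g: "Suc (g k) = 2 ^ k" for k by (simp add: g_def)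
    have sm: "strict_mono g"
      unfolding strict_mono_Suc_iff
    proof
      fix k
      have "Suc (g k) < Suc (g (Suc k))" unfolding Suc_g by simp
      then show "g k < g (Suc k)" by simp
    qed
    have zero: "dirichlet_term a n s = 0" if "n \<notin> range g" for n
    proof -
      have "Suc n \<notin> range (\<lambda>k. 2 ^ k)"
      proof
        assume "Suc n \<in> range (\<lambda>k. 2 ^ k)"
        then obtain k where "Suc n = Suc (g k)" unfolding Suc_g by blast
        then show False using that by simp
      qed
      then show ?thesis by (simp add: dirichlet_term_def a_def)
    qed
    have "(\<lambda>k. dirichlet_term a (g k) s) sums f (2 powr (- s))"
    proof -
      have "2 powr (- s) \<in> ball 0 1" using small[OF s] by simp
      from holomorphic_power_series[OF f this]
      have "(\<lambda>k. b k * (2 powr (- s)) ^ k) sums f (2 powr (- s))" by (simp add: b_def)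
      moreover have "dirichlet_term a (g k) s = b k * (2 powr (- s)) ^ k" for k
      proof -
        have "of_nat (2 ^ k) powr (- s) = exp (- s * of_real (ln (2 ^ k)))"
          by (simp add: powr_def Ln_of_nat flip: Ln_of_real)
        also have "\<dots> = (2 powr (- s)) ^ k"
          by (simp add: powr_def ln_realpow exp_of_nat_mult[symmetric] mult_ac Ln_of_real[of 2, simplified])
        finally show ?thesis unfolding dirichlet_term_def Suc_g a2 by simp
      qed
      ultimately show ?thesis by simp
    qed
    then show ?thesis using sums_mono_reindex[OF sm, of "\<lambda>n. dirichlet_term a n s"] zero by blast
  qed
  from hinf_of_dirichlet_series[OF this B[OF small]] show ?thesis using that by blast
qed

section \<open>Gliding humps in the unit disk\<close>

text \<open>The order of the choices matters: \<open>n\<close> makes \<open>r ^ n\<close> small,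
  then \<open>k\<close> brings \<open>u k ^ n\<close> close to 1, then \<open>m\<close> makes
  \<open>u k ^ m\<close> small, and finally \<open>r'\<close> is so close to 1 that points of the
  diameter disk beyond it are within about \<open>e / m\<close> of 1.\<close>

lemma exists_hump:
  fixes u :: "nat \<Rightarrow> complex"
  assumes lim: "u \<longlonglongrightarrow> 1" and u: "\<And>k. cmod (u k) < 1" and r: "0 \<le> r" "r < 1" and e: "e > 0"
  shows "\<exists>n m k r'. j \<le> n \<and> n \<le> m \<and> j \<le> k \<and> r < cmod (u k) \<and> cmod (u k) < r' \<and> r' < 1 \<and>
    cmod (u k ^ n - u k ^ m - 1) \<le> 1 / 8 \<and> 2 * r ^ n \<le> e \<and> real m * sqrt (1 - r'\<^sup>2) \<le> e"
proof -
  have "(\<lambda>n. r ^ n) \<longlonglongrightarrow> 0" using r by (intro LIMSEQ_realpow_zero)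
  then have "\<forall>\<^sub>F n in sequentially. r ^ n < e / 2" using e by (intro order_tendstoD) auto
  then have "\<forall>\<^sub>F n in sequentially. r ^ n < e / 2 \<and> j \<le> n" using eventually_ge_at_top by (rule eventually_conj)
  then obtain n where n: "r ^ n < e / 2" "j \<le> n" using eventually_happens' sequentially_bot by blast
  have "(\<lambda>k. cmod (u k)) \<longlonglongrightarrow> 1" using tendsto_norm[OF lim] by simp
  then have 1: "\<forall>\<^sub>F k in sequentially. r < cmod (u k)" using r by (intro order_tendstoD) auto
  have "(\<lambda>k. cmod (u k ^ n - 1)) \<longlonglongrightarrow> cmod (1 ^ n - 1)" by (intro tendsto_intros lim)
  then have 2: "\<forall>\<^sub>F k in sequentially. cmod (u k ^ n - 1) < 1 / 16" by (intro order_tendstoD(2)) auto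
  have "\<forall>\<^sub>F k in sequentially. r < cmod (u k) \<and> cmod (u k ^ n - 1) < 1 / 16 \<and> j \<le> k"
    by (intro eventually_conj 1 2 eventually_ge_at_top)
  then obtain k where k: "r < cmod (u k)" "cmod (u k ^ n - 1) < 1 / 16" "j \<le> k"
    using eventually_happens' sequentially_bot by blast
  have "(\<lambda>m. cmod (u k) ^ m) \<longlonglongrightarrow> 0" using u by (intro LIMSEQ_realpow_zero) auto
  then have "\<forall>\<^sub>F m in sequentially. cmod (u k) ^ m < 1 / 16" by (intro order_tendstoD) auto
  then have "\<forall>\<^sub>F m in sequentially. cmod (u k) ^ m < 1 / 16 \<and> n \<le> m" using eventually_ge_at_top by (rule eventually_conj)
  then obtain m where m: "cmod (u k) ^ m < 1 / 16" "n \<le> m" using eventually_happens' sequentially_bot by blast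
  have "((\<lambda>x. real m * sqrt (1 - x\<^sup>2)) \<longlongrightarrow> real m * sqrt (1 - 1\<^sup>2)) (at_left 1)" by (intro tendsto_intros)
  then have 3: "\<forall>\<^sub>F x in at_left 1. real m * sqrt (1 - x\<^sup>2) < e" using e by (intro order_tendstoD(2)) auto
  have "\<forall>\<^sub>F x in at_left 1. x \<in> {cmod (u k)<..<1}" by (intro eventually_at_left_real u)
  with 3 have "\<forall>\<^sub>F x in at_left 1. real m * sqrt (1 - x\<^sup>2) < e \<and> x \<in> {cmod (u k)<..<1}" by (rule eventually_conj)
  then obtain r' where r': "real m * sqrt (1 - r'\<^sup>2) < e" "cmod (u k) < r'" "r' < 1"
    using eventually_happens'[OF trivial_limit_at_left_real] by fastforce
  have "cmod (u k ^ n - u k ^ m - 1) \<le> cmod (u k ^ n - 1) + cmod (u k ^ m)"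
    using norm_triangle_ineq4[of "u k ^ n - 1" "u k ^ m"] by (simp add: algebra_simps)
  also have "\<dots> \<le> 1 / 8" using k(2) m(1) by (simp add: norm_power)
  finally show ?thesis
    using n m k r' by (intro exI[of _ n] exI[of _ m] exI[of _ k] exI[of _ r']) auto
qed

text \<open>A gliding hump: where \<open>cmod z \<le> r j\<close> the factor \<open>z ^ n j\<close> is small, and where
  \<open>cmod z \<ge> r (Suc j)\<close> the hypothesis on \<open>z\<close>, which says that \<open>z\<close> lies in the disk with diameter
  \<open>[0, 1]\<close>, makes \<open>z\<close> close to \<open>1\<close>.\<close>

lemma gliding_humps:
  fixes u :: "nat \<Rightarrow> complex" and \<epsilon> :: "nat \<Rightarrow> real"
  assumes lim: "u \<longlonglongrightarrow> 1" and u: "\<And>k. cmod (u k) < 1" "\<And>k. (cmod (1 - u k))\<^sup>2 \<le> 1 - (cmod (u k))\<^sup>2"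
    and \<epsilon>: "\<And>j. \<epsilon> j > 0"
  obtains n m k :: "nat \<Rightarrow> nat" where "\<And>j. j \<le> n j" "\<And>j. n j \<le> m j" "\<And>j. j \<le> k j"
    "\<And>j. cmod (u (k j) ^ n j - u (k j) ^ m j - 1) \<le> 1 / 8"
    "\<And>i j. i \<noteq> j \<Longrightarrow> cmod (u (k i) ^ n j - u (k i) ^ m j) \<le> \<epsilon> j"
    "\<And>z. cmod z < 1 \<Longrightarrow> (cmod (1 - z))\<^sup>2 \<le> 1 - (cmod z)\<^sup>2 \<Longrightarrow>
      \<exists>j0. \<forall>j. cmod (z ^ n j - z ^ m j) \<le> \<epsilon> j + (if j = j0 then 2 else 0)"
proof -
  define Q where "Q = (\<lambda>j r n m k r'. j \<le> n \<and> n \<le> m \<and> j \<le> k \<and> r < cmod (u k) \<and> cmod (u k) < r' \<and> r' < 1 \<and>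
      cmod (u k ^ n - u k ^ m - 1) \<le> 1 / 8 \<and> 2 * r ^ n \<le> \<epsilon> j \<and> real m * sqrt (1 - r'\<^sup>2) \<le> \<epsilon> j)"
  \<comment> \<open>A choice depends on the earlier ones only through the radius they leave behind,
    so the recursion runs over radii alone and \<open>n\<close>, \<open>m\<close>, \<open>k\<close>
    are read off afterwards.\<close>
  define P where "P = (\<lambda>j r. SOME (n, m, k, r'). Q j r n m k r')"
  define N M K R where "N = (\<lambda>j r. fst (P j r))" and "M = (\<lambda>j r. fst (snd (P j r)))"
    and "K = (\<lambda>j r. fst (snd (snd (P j r))))" and "R = (\<lambda>j r. snd (snd (snd (P j r))))"
  have step: "Q j r (N j r) (M j r) (K j r) (R j r)" if "0 \<le> r" "r < 1" for j r
  proof -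
    have "\<exists>p. case p of (n, m, k, r') \<Rightarrow> Q j r n m k r'"
      using exists_hump[OF lim u(1) that \<epsilon>[of j], of j] unfolding Q_def by auto
    then have "case P j r of (n, m, k, r') \<Rightarrow> Q j r n m k r'" unfolding P_def by (rule someI_ex)
    then show ?thesis by (simp add: N_def M_def K_def R_def split: prod.splits)
  qed
  define r where "r = rec_nat 0 R"
  have r0: "r 0 = 0" and rSuc: "r (Suc j) = R j (r j)" for j by (simp_all add: r_def)
  have r: "0 \<le> r j \<and> r j < 1" for j
  proof (induction j)
    case (Suc j)
    then show ?case unfolding rSuc using step[of "r j" j] norm_ge_zero[of "u (K j (r j))"] unfolding Q_def by linarith
  qed (simp add: r0)
  define n m k where "n = (\<lambda>j. N j (r j))" and "m = (\<lambda>j. M j (r j))" and "k = (\<lambda>j. K j (r j))"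
  have s: "j \<le> n j" "n j \<le> m j" "j \<le> k j" "r j < cmod (u (k j))" "cmod (u (k j)) < r (Suc j)"
      "cmod (u (k j) ^ n j - u (k j) ^ m j - 1) \<le> 1 / 8" "2 * r j ^ n j \<le> \<epsilon> j"
      "real (m j) * sqrt (1 - (r (Suc j))\<^sup>2) \<le> \<epsilon> j" for j
    using step[of "r j" j] r[of j] by (simp_all add: Q_def n_def m_def k_def rSuc)
  have "r j \<le> r (Suc j)" for j using s(4,5)[of j] by simp
  then have mono: "r i \<le> r j" if "i \<le> j" for i j using that by (rule lift_Suc_mono_le)
  have low: "cmod (z ^ n j - z ^ m j) \<le> \<epsilon> j" if z: "cmod z \<le> r j" for z j
  proof -
    have "cmod z < 1" using z r[of j] by simp
    have "cmod (z ^ n j - z ^ m j) \<le> cmod z ^ n j + cmod z ^ m j"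
      using norm_triangle_ineq4[of "z ^ n j" "z ^ m j"] by (simp add: norm_power)
    also have "\<dots> \<le> cmod z ^ n j + cmod z ^ n j"
      using \<open>cmod z < 1\<close> s(2)[of j] by (intro add_left_mono power_decreasing) auto
    also have "\<dots> \<le> r j ^ n j + r j ^ n j" using z by (intro add_mono power_mono) auto
    also have "\<dots> \<le> \<epsilon> j" using s(7)[of j] by simp
    finally show ?thesis .
  qed
  have high: "cmod (z ^ n j - z ^ m j) \<le> \<epsilon> j"
    if z: "cmod z < 1" "(cmod (1 - z))\<^sup>2 \<le> 1 - (cmod z)\<^sup>2" and zr: "r (Suc j) \<le> cmod z" for z j
  proof -
    have "z ^ m j = z ^ n j * z ^ (m j - n j)" using s(2)[of j] by (simp flip: power_add)
    then have "cmod (z ^ n j - z ^ m j) = cmod z ^ n j * cmod (1 ^ (m j - n j) - z ^ (m j - n j))"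
      by (simp add: norm_power norm_mult flip: right_diff_distrib) (metis mult.right_neutral norm_mult norm_power right_diff_distrib)
    also have "\<dots> \<le> 1 * cmod (1 ^ (m j - n j) - z ^ (m j - n j))"
      using z by (intro mult_right_mono power_le_one) auto
    also have "\<dots> \<le> 1 * (real (m j - n j) * cmod (1 - z))"
      using z by (intro mult_left_mono norm_power_diff) auto
    also have "\<dots> \<le> real (m j) * sqrt (1 - (r (Suc j))\<^sup>2)"
    proof -
      have "cmod (1 - z) \<le> sqrt (1 - (cmod z)\<^sup>2)" using z(2) by (rule real_le_rsqrt)
      also have "\<dots> \<le> sqrt (1 - (r (Suc j))\<^sup>2)"
        using zr r[of "Suc j"] by (intro real_sqrt_le_mono diff_left_mono power_mono) auto
      finally show ?thesis by (simp add: mult_mono)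
    qed
    also have "\<dots> \<le> \<epsilon> j" by (rule s(8))
    finally show ?thesis .
  qed
  have H: "cmod (z ^ n j - z ^ m j) \<le> \<epsilon> j"
    if z: "cmod z < 1" "(cmod (1 - z))\<^sup>2 \<le> 1 - (cmod z)\<^sup>2" and i: "r i < cmod z" "cmod z < r (Suc i)" and ne: "j \<noteq> i" for z i j
  proof (cases "j < i")
    case True
    then show ?thesis using mono[of "Suc j" i] i by (intro high z) auto
  next
    case False
    then show ?thesis using mono[of "Suc i" j] i ne by (intro low) auto
  qed
  show ?thesis
  proof (rule that[of n m k])
    show "cmod (u (k i) ^ n j - u (k i) ^ m j) \<le> \<epsilon> j" if "i \<noteq> j" for i j
      using that s(4,5)[of i] by (intro H[of _ i] u) auto
    show "\<exists>j0. \<forall>j. cmod (z ^ n j - z ^ m j) \<le> \<epsilon> j + (if j = j0 then 2 else 0)"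
      if z: "cmod z < 1" "(cmod (1 - z))\<^sup>2 \<le> 1 - (cmod z)\<^sup>2" for z
    proof (cases "\<exists>i. r i < cmod z \<and> cmod z < r (Suc i)")
      case True
      then obtain i where i: "r i < cmod z" "cmod z < r (Suc i)" by blast
      have "cmod (z ^ n i - z ^ m i) \<le> 2"
      proof -
        have "cmod (z ^ n i - z ^ m i) \<le> cmod z ^ n i + cmod z ^ m i"
          using norm_triangle_ineq4[of "z ^ n i" "z ^ m i"] by (simp add: norm_power)
        also have "\<dots> \<le> 1 + 1" using z by (intro add_mono power_le_one) auto
        finally show ?thesis by simp
      qed
      then have "cmod (z ^ n i - z ^ m i) \<le> \<epsilon> i + 2" using \<epsilon>[of i] by linarith
      then show ?thesis using H[OF z i] by (intro exI[of _ i]) auto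
    next
      \<comment> \<open>Here the modulus equals one of the radii or exceeds them all. No hump is
        large, and \<open>j0\<close> is arbitrary.\<close>
      case False
      then have "cmod z \<le> r j \<or> r (Suc j) \<le> cmod z" for j by (meson not_le)
      then have "cmod (z ^ n j - z ^ m j) \<le> \<epsilon> j" for j
        using low[of z j] high[OF z, of j] by blast
      then show ?thesis by (intro exI[of _ 0]) (auto intro: add_increasing2)
    qed
  qed (use s in auto)
qed

lemma geometric_sums_16: "(\<lambda>j. (1 / 2) ^ j / 16) sums (1 / 8 :: real)"
  using sums_divide[OF geometric_sums[of "1 / 2 :: real"], of 16] by simp

lemma hump_embedding:
  assumes w: "\<And>k. w k \<in> halfplane 0" and lim: "(\<lambda>k. Re (w k)) \<longlonglongrightarrow> 0"
  obtains J :: "linfty \<Rightarrow> hinf" and k :: "nat \<Rightarrow> nat" where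
    "\<And>x y. J (x + y) = J x + J y" "\<And>c x. J (c *\<^sub>C x) = c *\<^sub>C J x"
    "\<And>x. norm (J x) \<le> 3 * norm x"
    "\<And>x i. cmod (hinf_fun (J x) (w (k i)) - apply_bcontfun x i) \<le> norm x / 4"
    "\<And>x N. \<forall>j\<ge>N. apply_bcontfun x j = 0 \<Longrightarrow> (\<lambda>i. hinf_fun (J x) (w (k i))) \<longlonglongrightarrow> 0"
proof -
  define z where "z = (\<lambda>k. 2 powr (- w k))"
  have normz: "cmod (z k) = 2 powr (- Re (w k))" for k by (simp add: z_def norm_powr_real_powr)
  have z1: "cmod (z k) < 1" for k using w[of k] by (simp add: normz halfplane_def powr_less_one)
  have "seq_compact (cball (0::complex) 1)" by (intro compact_imp_seq_compact compact_cball)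
  moreover have "\<forall>k. z k \<in> cball 0 1" using z1 by (simp add: less_imp_le)
  ultimately obtain \<zeta> \<sigma> where \<sigma>: "strict_mono \<sigma>" and \<zeta>: "(z \<circ> \<sigma>) \<longlonglongrightarrow> \<zeta>"
    unfolding seq_compact_def by blast
  have "(\<lambda>k. cmod (z (\<sigma> k))) \<longlonglongrightarrow> cmod \<zeta>" using tendsto_norm[OF \<zeta>] by (simp add: o_def)
  moreover have "(\<lambda>k. 2 powr (- Re (w (\<sigma> k)))) \<longlonglongrightarrow> 2 powr (- 0)"
    using LIMSEQ_subseq_LIMSEQ[OF lim \<sigma>] by (intro tendsto_intros) (auto simp: o_def)
  ultimately have \<zeta>1: "cmod \<zeta> = 1" using LIMSEQ_unique by (fastforce simp: normz)
  define q where "q = (\<lambda>z. (1 + cnj \<zeta> * z) / 2)"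
  have q: "cmod (q z) < 1" "(cmod (1 - q z))\<^sup>2 \<le> 1 - (cmod (q z))\<^sup>2" "cmod (q z) \<le> (1 + cmod z) / 2" if "cmod z < 1" for z
  proof -
    let ?v = "cnj \<zeta> * z"
    have v: "cmod ?v = cmod z" using \<zeta>1 by (simp add: norm_mult)
    have "cmod (1 + ?v) \<le> 1 + cmod z" using norm_triangle_ineq[of 1 ?v] v by simp
    then show "cmod (q z) \<le> (1 + cmod z) / 2" by (simp add: q_def norm_divide)
    then show "cmod (q z) < 1" using that by simp
    \<comment> \<open>The parallelogram law; it places \<open>q z\<close> in the disk with diameter
      [0, 1].\<close>
    have "(cmod (1 - ?v))\<^sup>2 + (cmod (1 + ?v))\<^sup>2 = 2 + 2 * (cmod ?v)\<^sup>2"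
      unfolding cmod_power2 by (simp add: power2_eq_square algebra_simps)
    also have "\<dots> \<le> 4" using that unfolding v by (simp add: power_le_one)
    finally have "(cmod (1 - ?v) / 2)\<^sup>2 \<le> 1 - (cmod (1 + ?v) / 2)\<^sup>2" by (simp add: power_divide)
    moreover have eq: "1 - q z = (1 - ?v) / 2" by (simp add: q_def field_simps)
    ultimately show "(cmod (1 - q z))\<^sup>2 \<le> 1 - (cmod (q z))\<^sup>2"
      unfolding eq by (simp add: q_def norm_divide)
  qed
  define u where "u = (\<lambda>k. q (z (\<sigma> k)))"
  have ulim: "u \<longlonglongrightarrow> 1"
  proof -
    have "(\<lambda>k. (1 + cnj \<zeta> * z (\<sigma> k)) / 2) \<longlonglongrightarrow> (1 + cnj \<zeta> * \<zeta>) / 2"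
      using \<zeta> by (intro tendsto_intros) (auto simp: o_def)
    moreover have "cnj \<zeta> * \<zeta> = 1" using complex_norm_square[of \<zeta>] \<zeta>1 by (simp add: mult.commute)
    ultimately show ?thesis by (simp add: u_def[abs_def] q_def)
  qed
  \<comment> \<open>The total 1/8 gives the bound 2 + 1/8 \<le> 3 for the norm of \<open>J\<close>,
    and together with the error 1/8 of the central hump the 1/4 at the selected points.\<close>
  define \<epsilon> where "\<epsilon> = (\<lambda>j. (1 / 2) ^ j / 16 :: real)"
  have \<epsilon>: "\<epsilon> j > 0" for j by (simp add: \<epsilon>_def)
  have \<epsilon>sum: "\<epsilon> sums (1 / 8)" unfolding \<epsilon>_def by (rule geometric_sums_16)
  have uprop: "cmod (u k) < 1" "(cmod (1 - u k))\<^sup>2 \<le> 1 - (cmod (u k))\<^sup>2" for k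
    unfolding u_def by (rule q z1)+
  obtain n m k where nmk: "\<And>j. j \<le> n j" "\<And>j. n j \<le> m j" "\<And>j. j \<le> k j"
    and near: "\<And>j. cmod (u (k j) ^ n j - u (k j) ^ m j - 1) \<le> 1 / 8"
    and far: "\<And>i j. i \<noteq> j \<Longrightarrow> cmod (u (k i) ^ n j - u (k i) ^ m j) \<le> \<epsilon> j"
    and all: "\<And>z. cmod z < 1 \<Longrightarrow> (cmod (1 - z))\<^sup>2 \<le> 1 - (cmod z)\<^sup>2 \<Longrightarrow>
      \<exists>j0. \<forall>j. cmod (z ^ n j - z ^ m j) \<le> \<epsilon> j + (if j = j0 then 2 else 0)"
    by (rule gliding_humps[of u \<epsilon>, OF ulim uprop \<epsilon>]) (rule that)
  define H where "H = (\<lambda>j z. q z ^ n j - q z ^ m j)"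
  \<comment> \<open>The bound \<open>all\<close> singles out an index that varies with
    \<open>z\<close>, so it gives no common majorant of the terms. The geometric one obtained here
    from \<open>j \<le> n j \<le> m j\<close> yields holomorphy of the sum, and \<open>all\<close>
    its size.\<close>
  have Hle: "cmod (H j z) \<le> 2 * cmod (q z) ^ j" if "cmod z < 1" for j z
  proof -
    have "cmod (H j z) \<le> cmod (q z) ^ n j + cmod (q z) ^ m j"
      unfolding H_def using norm_triangle_ineq4[of "q z ^ n j" "q z ^ m j"] by (simp add: norm_power)
    also have "\<dots> \<le> cmod (q z) ^ j + cmod (q z) ^ j"
      using q(1)[OF that] nmk(1)[of j] nmk(2)[of j] by (intro add_mono power_decreasing) auto
    finally show ?thesis by simp
  qed
  have holq: "q holomorphic_on A" for A unfolding q_def by (intro holomorphic_intros) auto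
  have "\<exists>g. (\<forall>s\<in>halfplane 0. (\<lambda>j. apply_bcontfun x j * H j (2 powr (- s))) sums hinf_fun g s) \<and> norm g \<le> 3 * norm x"
    for x :: linfty
  proof -
    let ?f = "\<lambda>j z. apply_bcontfun x j * H j z"
    obtain G where G: "\<forall>z\<in>ball 0 1. ((\<lambda>j. ?f j z) sums G z) \<and> G field_differentiable (at z)"
    proof (rule series_differentiable_comparison_complex[of "ball 0 1" ?f])
      show "?f j field_differentiable (at z)" if "z \<in> ball 0 1" for j z
      proof -
        have "?f j holomorphic_on ball 0 1" unfolding H_def by (intro holomorphic_intros holq)
        then show ?thesis using that by (simp add: holomorphic_on_imp_differentiable_at)
      qed
      fix z :: complex assume z: "z \<in> ball 0 1"
      define d where "d = (1 - cmod z) / 2"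
      have d: "d > 0" using z by (simp add: d_def)
      define \<rho> where "\<rho> = (1 + (cmod z + d)) / 2"
      have \<rho>: "0 < \<rho>" "\<rho> < 1" using z d by (auto simp: \<rho>_def d_def field_simps intro: add_nonneg_pos)
      define h where "h = (\<lambda>j. of_real (norm x * (2 * \<rho> ^ j)) :: complex)"
      have "summable (\<lambda>j. \<rho> ^ j)" using \<rho> by (simp add: summable_geometric)
      then have "summable h" unfolding h_def by (intro summable_of_real summable_mult)
      moreover have "range h \<subseteq> \<real>\<^sub>\<ge>\<^sub>0" using \<rho> by (auto simp: h_def simp del: of_real_mult of_real_power)
      moreover have "\<forall>j. \<forall>y\<in>ball z d \<inter> ball 0 1. cmod (?f j y) \<le> cmod (h j)"
      proof (intro allI ballI)
        fix j y assume y: "y \<in> ball z d \<inter> ball 0 1"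
        have y1: "cmod y < 1" using y by simp
        have "cmod (z - y) < d" using y by (simp add: dist_norm)
        then have "cmod y \<le> cmod z + d" using norm_triangle_ineq3[of z y] by linarith
        then have "cmod (q y) \<le> \<rho>" using q(3)[OF y1] by (simp add: \<rho>_def)
        then have "2 * cmod (q y) ^ j \<le> 2 * \<rho> ^ j" by (simp add: power_mono)
        then have "cmod (?f j y) \<le> norm x * (2 * \<rho> ^ j)"
          unfolding norm_mult using norm_bounded[of x j] Hle[OF y1, of j] by (intro mult_mono) auto
        also have "\<dots> = cmod (h j)" unfolding h_def norm_of_real using \<rho> by simp
        finally show "cmod (?f j y) \<le> cmod (h j)" .
      qed
      ultimately show "\<exists>d h. 0 < d \<and> summable h \<and> range h \<subseteq> \<real>\<^sub>\<ge>\<^sub>0 \<and>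
          (\<forall>\<^sub>F j in sequentially. \<forall>y\<in>ball z d \<inter> ball 0 1. cmod (?f j y) \<le> cmod (h j))"
        using d by (intro exI[of _ d] exI[of _ h]) (auto intro!: always_eventually)
    qed auto
    have holG: "G holomorphic_on ball 0 1"
      using G by (auto simp: holomorphic_on_def intro: field_differentiable_at_within)
    have Gle: "cmod (G z) \<le> 3 * norm x" if z: "cmod z < 1" for z
    proof -
      obtain j0 where j0: "\<And>j. cmod (H j z) \<le> \<epsilon> j + (if j = j0 then 2 else 0)"
        using all[OF q(1,2)[OF z]] unfolding H_def by blast
      have "(\<lambda>j. if j = j0 then 2 else 0 :: real) sums 2" using sums_single[of j0 "\<lambda>_. 2 :: real"] .
      then have sums: "(\<lambda>j. norm x * (\<epsilon> j + (if j = j0 then 2 else 0))) sums (norm x * (1 / 8 + 2))"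
        by (intro sums_mult sums_add \<epsilon>sum)
      have Gz: "G z = (\<Sum>j. ?f j z)" using G z by (simp add: sums_iff)
      have "cmod (\<Sum>j. ?f j z) \<le> (\<Sum>j. norm x * (\<epsilon> j + (if j = j0 then 2 else 0)))"
      proof (rule norm_suminf_le[OF _ sums_summable[OF sums]])
        show "norm (?f j z) \<le> norm x * (\<epsilon> j + (if j = j0 then 2 else 0))" for j
          unfolding norm_mult by (intro mult_mono[OF norm_bounded j0]) auto
      qed
      also have "\<dots> = norm x * (1 / 8 + 2)" using sums by (simp add: sums_iff)
      also have "\<dots> \<le> norm x * 3" by (intro mult_left_mono) auto
      finally show ?thesis unfolding Gz by simp
    qed
    obtain g where g: "\<And>s. s \<in> halfplane 0 \<Longrightarrow> hinf_fun g s = G (2 powr (- s))" "norm g \<le> 3 * norm x"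
      using hinf_of_power_series[OF holG Gle] by blast
    have "(\<lambda>j. ?f j (2 powr (- s))) sums hinf_fun g s" if s: "s \<in> halfplane 0" for s
    proof -
      have "2 powr (- s) \<in> ball 0 1"
        using s by (simp add: halfplane_def norm_powr_real_powr powr_less_one)
      then show ?thesis using G g(1)[OF s] by simp
    qed
    with g(2) show ?thesis by blast
  qed
  then obtain J where J: "\<And>x s. s \<in> halfplane 0 \<Longrightarrow> (\<lambda>j. apply_bcontfun x j * H j (2 powr (- s))) sums hinf_fun (J x) s"
      "\<And>x. norm (J x) \<le> 3 * norm x"
    by metis
  define \<kappa> where "\<kappa> = (\<lambda>i. \<sigma> (k i))"
  have Jw: "(\<lambda>j. apply_bcontfun x j * (u (k i) ^ n j - u (k i) ^ m j)) sums hinf_fun (J x) (w (\<kappa> i))" for x i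
    using J(1)[OF w[of "\<kappa> i"], of x] by (simp add: \<kappa>_def H_def u_def z_def)
  show ?thesis
  proof (rule that[of J \<kappa>])
    show "J (x + y) = J x + J y" for x y
    proof (rule hinf_eqI)
      fix s assume s: "s \<in> halfplane 0"
      show "hinf_fun (J (x + y)) s = hinf_fun (J x + J y) s"
        using sums_add[OF J(1)[OF s, of x] J(1)[OF s, of y]] J(1)[OF s, of "x + y"]
        by (simp add: distrib_right sums_unique2)
    qed
    show "J (c *\<^sub>C x) = c *\<^sub>C J x" for c x
    proof (rule hinf_eqI)
      fix s assume s: "s \<in> halfplane 0"
      show "hinf_fun (J (c *\<^sub>C x)) s = hinf_fun (c *\<^sub>C J x) s"
        using sums_mult[OF J(1)[OF s, of x], of c] J(1)[OF s, of "c *\<^sub>C x"]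
        by (simp add: scaleC_complex_def mult.assoc sums_unique2)
    qed
    show "norm (J x) \<le> 3 * norm x" for x by (rule J)
    show "cmod (hinf_fun (J x) (w (\<kappa> i)) - apply_bcontfun x i) \<le> norm x / 4" for x i
    proof -
      let ?t = "\<lambda>j. apply_bcontfun x j * (u (k i) ^ n j - u (k i) ^ m j) - (if j = i then apply_bcontfun x j else 0)"
      have "?t sums (hinf_fun (J x) (w (\<kappa> i)) - apply_bcontfun x i)"
        by (intro sums_diff Jw sums_single)
      then have eq: "hinf_fun (J x) (w (\<kappa> i)) - apply_bcontfun x i = suminf ?t" by (simp add: sums_iff)
      have "(\<lambda>j. if j = i then 1 / 8 else 0 :: real) sums (1 / 8)" using sums_single[of i "\<lambda>_. 1 / 8 :: real"] .
      then have sums: "(\<lambda>j. norm x * (\<epsilon> j + (if j = i then 1 / 8 else 0))) sums (norm x * (1 / 8 + 1 / 8))"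
        by (intro sums_mult sums_add \<epsilon>sum)
      have "cmod (?t j) \<le> norm x * (\<epsilon> j + (if j = i then 1 / 8 else 0))" for j
      proof (cases "j = i")
        case True
        have "?t j = apply_bcontfun x i * (u (k i) ^ n i - u (k i) ^ m i - 1)" using True by (simp add: algebra_simps)
        then have "cmod (?t j) \<le> norm x * (1 / 8)"
          using norm_bounded[of x i] near[of i] by (simp only: norm_mult) (intro mult_mono, auto)
        also have "\<dots> \<le> norm x * (\<epsilon> j + 1 / 8)" using \<epsilon>[of j] by (intro mult_left_mono) auto
        finally show ?thesis using True by simp
      next
        case False
        then show ?thesis using norm_bounded[of x j] far[of i j] by (simp add: norm_mult mult_mono)
      qed
      then have "cmod (suminf ?t) \<le> (\<Sum>j. norm x * (\<epsilon> j + (if j = i then 1 / 8 else 0)))"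
        by (intro norm_suminf_le sums_summable[OF sums])
      also have "\<dots> = norm x * (1 / 8 + 1 / 8)" using sums by (simp add: sums_iff)
      finally show ?thesis unfolding eq by simp
    qed
    \<comment> \<open>Only finitely many humps occur, and each tends to 1 - 1 as the points
      \<open>u (k i)\<close> tend to 1.\<close>
    show "(\<lambda>i. hinf_fun (J x) (w (\<kappa> i))) \<longlonglongrightarrow> 0" if x: "\<forall>j\<ge>N. apply_bcontfun x j = 0" for x N
    proof -
      have "(\<lambda>j. apply_bcontfun x j * (u (k i) ^ n j - u (k i) ^ m j)) sums
          (\<Sum>j<N. apply_bcontfun x j * (u (k i) ^ n j - u (k i) ^ m j))" for i
        by (rule sums_finite) (auto simp: x)
      then have eq: "hinf_fun (J x) (w (\<kappa> i)) = (\<Sum>j<N. apply_bcontfun x j * (u (k i) ^ n j - u (k i) ^ m j))" for i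
        using Jw sums_unique2 by blast
      have "filterlim k at_top sequentially"
        using nmk(3) by (intro filterlim_at_top_mono[OF filterlim_ident]) auto
      from filterlim_compose[OF ulim this] have "(\<lambda>i. u (k i)) \<longlonglongrightarrow> 1" .
      then have "(\<lambda>i. \<Sum>j<N. apply_bcontfun x j * (u (k i) ^ n j - u (k i) ^ m j)) \<longlonglongrightarrow>
          (\<Sum>j<N. apply_bcontfun x j * (1 ^ n j - 1 ^ m j))" by (intro tendsto_intros)
      then show ?thesis by (simp add: eq)
    qed
  qed
qed

section \<open>Symbols whose image is contained in no smaller half-plane\<close>

lemma normed_isomorphism_bounded_below:
  assumes Z: "csubspace Z" and add: "\<And>x y. x \<in> Z \<Longrightarrow> y \<in> Z \<Longrightarrow> T (x + y) = T x + T y"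
    and scale: "\<And>c x. x \<in> Z \<Longrightarrow> T (c *\<^sub>C x) = c *\<^sub>C T x"
    and B: "\<And>x. x \<in> Z \<Longrightarrow> norm (T x) \<le> B * norm x"
    and \<delta>: "\<delta> > 0" "\<And>x. x \<in> Z \<Longrightarrow> \<delta> * norm x \<le> norm (T x)"
  shows "normed_isomorphism Z (T ` Z) T"
proof -
  have diff: "x - y \<in> Z" "T (x - y) = T x - T y" if "x \<in> Z" "y \<in> Z" for x y
  proof -
    have neg: "(-1) *\<^sub>C y = - y" "(-1) *\<^sub>C T y = - T y"
      using scaleC_of_real[of "-1" y] scaleC_of_real[of "-1" "T y"] by simp_all
    then have y: "- y \<in> Z" "T (- y) = - T y"
      using Z that scale[of y "-1"] unfolding csubspace_def by metis+
    have "x + - y \<in> Z" using Z that y(1) unfolding csubspace_def by blast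
    moreover have "T (x + - y) = T x + - T y" using add[OF that(1) y(1)] y(2) by metis
    ultimately show "x - y \<in> Z" "T (x - y) = T x - T y" by simp_all
  qed
  have dist_le: "dist (T x) (T y) \<le> B * dist x y" "\<delta> * dist x y \<le> dist (T x) (T y)" if "x \<in> Z" "y \<in> Z" for x y
    using B[OF diff(1)[OF that]] \<delta>(2)[OF diff(1)[OF that]] diff(2)[OF that] by (auto simp: dist_norm)
  have inj: "inj_on T Z"
  proof (rule inj_onI)
    fix x y assume "x \<in> Z" "y \<in> Z" "T x = T y"
    then have "\<delta> * dist x y \<le> 0" using dist_le(2)[of x y] by simp
    then show "x = y" using \<delta>(1) by (simp add: mult_le_0_iff)
  qed
  define S where "S = the_inv_into Z T"
  have ST: "S (T x) = x" if "x \<in> Z" for x unfolding S_def using inj that by (rule the_inv_into_f_f)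
  have "homeomorphism Z (T ` Z) T S"
  proof (rule homeomorphismI)
    show "continuous_on Z T"
    proof (intro lipschitz_on_continuous_on[of "max B 0"] lipschitz_onI)
      fix x y assume xy: "x \<in> Z" "y \<in> Z"
      show "dist (T x) (T y) \<le> max B 0 * dist x y"
        using dist_le(1)[OF xy] mult_right_mono[of B "max B 0" "dist x y"] by simp
    qed simp
    show "continuous_on (T ` Z) S"
    proof (intro lipschitz_on_continuous_on[of "1 / \<delta>"] lipschitz_onI)
      fix x y assume "x \<in> T ` Z" "y \<in> T ` Z"
      then show "dist (S x) (S y) \<le> 1 / \<delta> * dist x y"
        using dist_le(2) \<delta>(1) by (auto simp: ST field_simps)
    qed (use \<delta>(1) in simp)
  qed (auto simp: ST)
  then show ?thesis unfolding normed_isomorphism_def using add scale by blast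
qed

text \<open>The humps are selected along points \<open>\<Phi> (s k)\<close>, so that the values of
  \<open>J x\<close> there are values of \<open>C (J x)\<close> at points of the half-plane. Hence
  lower bounds on \<open>J x\<close> at the selected points survive composition.\<close>

lemma composition_operator_fixes_linfty:
  assumes \<Phi>: "\<Phi> ` halfplane 0 \<subseteq> halfplane 0" and not: "\<And>\<epsilon>. \<epsilon> > 0 \<Longrightarrow> \<not> \<Phi> ` halfplane 0 \<subseteq> halfplane \<epsilon>"
    and C: "is_composition_operator \<Phi> C" "bounded_clinear C"
  shows "fixes_copy C TYPE(linfty)" and "\<not> weakly_compact_operator C"
proof -
  have C_eq: "hinf_fun (C f) s = hinf_fun f (\<Phi> s)" if "s \<in> halfplane 0" for f s
    using C(1) that by (simp add: is_composition_operator_def)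
  interpret C: bounded_linear C using C(2) by (simp add: bounded_clinear_def)
  have CC: "C (c *\<^sub>C f) = c *\<^sub>C C f" for c f using C(2) by (simp add: bounded_clinear_def)
  have "\<exists>s. s \<in> halfplane 0 \<and> Re (\<Phi> s) \<le> 1 / real (Suc k)" for k
    using not[of "1 / real (Suc k)"] by (auto simp: halfplane_def not_less)
  then obtain s where s: "\<And>k. s k \<in> halfplane 0" "\<And>k. Re (\<Phi> (s k)) \<le> 1 / real (Suc k)" by metis
  define w where "w = (\<lambda>k. \<Phi> (s k))"
  have w: "w k \<in> halfplane 0" for k using s(1) \<Phi> by (auto simp: w_def)
  have "(\<lambda>k. Re (w k)) \<longlonglongrightarrow> 0"
  proof (rule tendsto_sandwich[of "\<lambda>_. 0" _ _ "\<lambda>k. 1 / real (Suc k)"])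
    show "(\<lambda>k. 1 / real (Suc k)) \<longlonglongrightarrow> 0" using LIMSEQ_inverse_real_of_nat by (simp add: inverse_eq_divide)
    show "\<forall>\<^sub>F k in sequentially. 0 \<le> Re (w k)" using w by (auto simp: halfplane_def less_imp_le)
    show "\<forall>\<^sub>F k in sequentially. Re (w k) \<le> 1 / real (Suc k)" using s(2) by (simp add: w_def)
  qed simp
  then obtain J :: "linfty \<Rightarrow> hinf" and k :: "nat \<Rightarrow> nat" where
      J_add: "\<And>x y. J (x + y) = J x + J y" and J_scale: "\<And>c x. J (c *\<^sub>C x) = c *\<^sub>C J x"
      and J_le: "\<And>x. norm (J x) \<le> 3 * norm x"
      and J_near: "\<And>x i. cmod (hinf_fun (J x) (w (k i)) - apply_bcontfun x i) \<le> norm x / 4"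
      and J_null: "\<And>x N. \<forall>j\<ge>N. apply_bcontfun x j = 0 \<Longrightarrow> (\<lambda>i. hinf_fun (J x) (w (k i))) \<longlonglongrightarrow> 0"
    by (rule hump_embedding[of w, OF w]) (rule that)
  define t where "t = (\<lambda>i. s (k i))"
  have t: "t i \<in> halfplane 0" for i by (simp add: t_def s)
  have CJ: "hinf_fun (C (J x)) (t i) = hinf_fun (J x) (w (k i))" for x i
    using C_eq[OF t] by (simp add: t_def w_def)

  have below: "3 / 4 * norm x \<le> norm (C (J x))" for x
  proof -
    have "cmod (apply_bcontfun x i) \<le> norm (C (J x)) + norm x / 4" for i
    proof -
      have "cmod (hinf_fun (J x) (w (k i))) \<le> norm (C (J x))"
        using cmod_hinf_fun_le_norm[OF t, of "C (J x)" i] by (simp add: CJ)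
      then show ?thesis using J_near[of x i] by norm
    qed
    then have "norm x \<le> norm (C (J x)) + norm x / 4" by (rule norm_bound)
    then show ?thesis by simp
  qed
  have C_le: "norm (C f) \<le> norm f" for f
  proof (rule norm_hinf_le)
    fix s assume s: "s \<in> halfplane 0"
    then have "\<Phi> s \<in> halfplane 0" using \<Phi> by blast
    then show "cmod (hinf_fun (C f) s) \<le> norm f" using C_eq[OF s] cmod_hinf_fun_le_norm by simp
  qed
  have J0: "J 0 = 0" using J_add[of 0 0] by simp
  have sub: "csubspace (range J)"
    unfolding csubspace_def
  proof (intro conjI ballI allI)
    show "0 \<in> range J" by (rule range_eqI[of _ _ 0]) (simp add: J0)
    show "x + y \<in> range J" if "x \<in> range J" "y \<in> range J" for x y
      using that by (auto simp flip: J_add)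
    show "c *\<^sub>C x \<in> range J" if "x \<in> range J" for c x
      using that by (auto simp flip: J_scale)
  qed
  have "normed_isomorphism UNIV (range J) J"
  proof (rule normed_isomorphism_bounded_below[where B = 3 and \<delta> = "3 / 4"])
    show "csubspace (UNIV :: linfty set)" by (simp add: csubspace_def)
    show "3 / 4 * norm x \<le> norm (J x)" for x using below[of x] C_le[of "J x"] by linarith
  qed (use J_add J_scale J_le in auto)
  moreover have "normed_isomorphism (range J) (C ` range J) C"
  proof (rule normed_isomorphism_bounded_below[where B = 1 and \<delta> = "1 / 4"])
    \<comment> \<open>The lower bound 3/4 for the composite, divided by the bound 3 for
      \<open>J\<close>.\<close>
    show "1 / 4 * norm f \<le> norm (C f)" if f: "f \<in> range J" for f
    proof -
      obtain x where "f = J x" using f by blast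
      then show ?thesis using below[of x] J_le[of x] by simp
    qed
  qed (use sub C_le CC in \<open>auto simp: C.add\<close>)
  ultimately show "fixes_copy C TYPE(linfty)" unfolding fixes_copy_def using sub by blast

  show "\<not> weakly_compact_operator C"
  proof
    assume "weakly_compact_operator C"
    then have K: "compactin weak_topology (weak_topology closure_of (C ` cball 0 1))" (is "compactin _ ?K")
      by (simp add: weakly_compact_operator_def)
    obtain \<phi> :: "hinf \<Rightarrow> complex" where \<phi>: "bounded_clinear \<phi>"
        and \<phi>_lim: "\<And>f l. (\<lambda>i. hinf_fun f (t i)) \<longlonglongrightarrow> l \<Longrightarrow> \<phi> f = l"
        and \<phi>_closed: "\<And>f S. closed S \<Longrightarrow> \<forall>i. hinf_fun f (t i) \<in> S \<Longrightarrow> \<phi> f \<in> S"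
      by (rule cluster_evaluation[of t, OF t]) (rule that)
    have "\<exists>x :: linfty. apply_bcontfun x = (\<lambda>j. if j \<le> n then 1 else 0)" for n
    proof -
      have "bounded (range (\<lambda>j. if j \<le> n then 1 else 0 :: complex))"
        by (rule finite_imp_bounded, rule finite_subset[of _ "{0,1}"]) auto
      then show ?thesis using bounded_sequence_linfty by metis
    qed
    then obtain x :: "nat \<Rightarrow> linfty" where x: "\<And>n. apply_bcontfun (x n) = (\<lambda>j. if j \<le> n then 1 else 0)" by metis
    have x1: "norm (x n) \<le> 1" for n by (rule norm_bound) (simp add: x)
    \<comment> \<open>Since \<open>J\<close> is bounded by 3, the factor 1/3 puts the arguments into
      the unit ball.\<close>
    define g where "g = (\<lambda>n. C ((1 / 3) *\<^sub>R J (x n)))"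
    have gK: "g n \<in> ?K" for n
    proof -
      have "norm ((1 / 3) *\<^sub>R J (x n)) \<le> 1" using J_le[of "x n"] x1[of n] by simp
      then have "g n \<in> C ` cball 0 1" by (simp add: g_def)
      then show ?thesis using closure_of_subset[of "C ` cball 0 1" weak_topology] by (auto simp: topspace_weak_topology)
    qed
    have g_eq: "hinf_fun (g n) (t i) = hinf_fun (J (x n)) (w (k i)) / 3" for n i
      using CJ by (simp add: g_def C.scaleR)
    \<comment> \<open>The disk of radius 1/4 about 1, scaled by 1/3. That it omits 0 gives the
      contradiction.\<close>
    define S where "S = cball (1 / 3 :: complex) (1 / 12)"
    have g0: "\<phi> (g n) = 0" for n
    proof -
      have "(\<lambda>i. hinf_fun (J (x n)) (w (k i))) \<longlonglongrightarrow> 0" by (rule J_null[of "Suc n"]) (simp add: x)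
      then have "(\<lambda>i. hinf_fun (g n) (t i)) \<longlonglongrightarrow> 0 / 3" unfolding g_eq by (intro tendsto_intros) simp_all
      then show ?thesis by (simp add: \<phi>_lim)
    qed
    have gS: "hinf_fun (g n) (t i) \<in> S" if "i \<le> n" for i n
    proof -
      have "cmod (hinf_fun (J (x n)) (w (k i)) - 1) \<le> 1 / 4"
        using J_near[of "x n" i] x1[of n] that by (simp add: x)
      moreover have "1 / 3 - hinf_fun (g n) (t i) = - ((hinf_fun (J (x n)) (w (k i)) - 1) / 3)"
        by (simp add: g_eq diff_divide_distrib)
      ultimately show ?thesis by (simp add: S_def dist_norm norm_divide)
    qed
    \<comment> \<open>The finite intersection property replaces the extraction of a cluster point:
      finitely many of these weakly closed sets contain a common \<open>g n\<close>, with
      \<open>n\<close> at least all their indices.\<close>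
    define D where "D = (\<lambda>i. {f. \<phi> f \<in> {0}} \<inter> {f. hinf_fun f (t i) \<in> S})"
    have "closedin weak_topology (D i)" for i
      unfolding D_def
    proof (rule closedin_Int)
      have "closedin weak_topology {f \<in> topspace weak_topology. \<psi> f \<in> A}" if "bounded_clinear \<psi>" "closed A" for \<psi> :: "hinf \<Rightarrow> complex" and A
        using that by (intro closedin_continuous_map_preimage[OF continuous_map_weak_topology]) auto
      then have cl: "closedin weak_topology {f. \<psi> f \<in> A}" if "bounded_clinear \<psi>" "closed A" for \<psi> :: "hinf \<Rightarrow> complex" and A
        using that by (simp add: topspace_weak_topology)
      show "closedin weak_topology {f. \<phi> f \<in> {0}}" by (rule cl) (simp_all add: \<phi>)
      show "closedin weak_topology {f. hinf_fun f (t i) \<in> S}"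
        by (rule cl) (simp_all add: bounded_clinear_evaluation t S_def)
    qed
    moreover have "?K \<inter> \<Inter> F \<noteq> {}" if F: "finite F" "F \<subseteq> range D" for F
    proof -
      obtain I where I: "finite I" "F = D ` I" using finite_subset_image[OF F] by blast
      \<comment> \<open>Inserting 0 keeps the maximum meaningful when \<open>I\<close> is
        empty.\<close>
      have "g (Max (insert 0 I)) \<in> D i" if "i \<in> I" for i
        using that I g0 gS[of i] by (simp add: D_def)
      then show ?thesis using gK I by blast
    qed
    ultimately have "?K \<inter> \<Inter> (range D) \<noteq> {}"
      using K[unfolded compactin_fip] by blast
    then obtain f where f: "\<And>i. f \<in> D i" by blast
    have "\<phi> f \<in> S" using f by (intro \<phi>_closed) (auto simp: D_def S_def)
    moreover have "\<phi> f = 0" using f[of 0] by (simp add: D_def)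
    ultimately show False by (simp add: S_def dist_norm norm_divide)
  qed
qed

theorem theorem3p4:
  fixes \<Phi> :: "complex \<Rightarrow> complex" and C\<^sub>\<Phi> :: "hinf \<Rightarrow> hinf"
  assumes "\<Phi> ` halfplane 0 \<subseteq> halfplane 0"
    and "is_composition_operator \<Phi> C\<^sub>\<Phi>"
    and "bounded_clinear C\<^sub>\<Phi>"
  shows "((\<exists>\<epsilon>>0. \<Phi> ` halfplane 0 \<subseteq> halfplane \<epsilon>) \<longleftrightarrow> compact_operator C\<^sub>\<Phi>) \<and>
    (compact_operator C\<^sub>\<Phi> \<longleftrightarrow> weakly_compact_operator C\<^sub>\<Phi>) \<and>
    (weakly_compact_operator C\<^sub>\<Phi> \<longleftrightarrow> \<not> fixes_copy C\<^sub>\<Phi> TYPE(linfty))"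
proof (cases "\<exists>\<epsilon>>0. \<Phi> ` halfplane 0 \<subseteq> halfplane \<epsilon>")
  case True
  then have "compact_operator C\<^sub>\<Phi>"
    using composition_operator_compact assms by blast
  then show ?thesis
    using True compact_imp_weakly_compact_operator compact_operator_not_fixes_linfty by blast
next
  case False
  then have "fixes_copy C\<^sub>\<Phi> TYPE(linfty)" "\<not> weakly_compact_operator C\<^sub>\<Phi>"
    using composition_operator_fixes_linfty[OF assms(1) _ assms(2,3)] by blast+
  then show ?thesis
    using False compact_imp_weakly_compact_operator by blast
qed

end
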